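(* Let $\sigma_1\ge\sigma_2\ge\dots\ge0$ be real numbers with $\lim_{k\to\infty}\sigma_k=0$ and $\sum_{j=1}^\infty\sigma_j^2=\infty$, and let $\tau_0\ge\tau_1\ge\dots\ge0$ be real numbers with $\lim_{n\to\infty}\tau_n=0$. Then there is a Hilbert space $H\subset\ell_2(\mathbb{N})$, compactly embedded into $\ell_2(\mathbb{N})$, such that $a_n(H,\ell_2)=\sigma_{n+1}$ for all $n\in\mathbb{N}_0$, and there is some $h\in\ell_2(\mathbb{N})$ with $\|h\|_2=1$, such that $$g_n(H,\ell_2)\;\ge\;e_n(H,\mathrm{INT}_h)\;\ge\;\tau_n$$ for all except finitely many $n\in\mathbb{N}$.
   Context: All sequence spaces are real; $\ell_2=\ell_2(\mathbb{N})$ with norm $\|\cdot\|_2$. A Hilbert space $H\subset\ell_2(\mathbb{N})$ is a linear subspace of $\ell_2(\mathbb{N})$ equipped with its own Hilbert space norm $\|\cdot\|_H$, such that the inclusion into $\ell_2(\mathbb{N})$ is continuous (here compact); it is a reproducing kernel Hilbert space of functions on the domain $\mathbb{N}$, function values being the coordinates $f_x$, $x\in\mathbb{N}$. For $h\in\ell_2(\mathbb{N})$, $\mathrm{INT}_h(f)=\sum_{j=1}^\infty h_jf_j$. For $n\in\mathbb{N}_0$: - $a_n(H,\ell_2)=\inf_{A_n}\sup_{\|f\|_H\le1}\|f-A_n(f)\|_2$, infimum over all $A_n(f)=\sum_{i=1}^nL_i(f)g_i$ with linear functionals $L_i$ on $H$ and $g_i\in\ell_2$; - $g_n(H,\ell_2)=\inf_{S_n}\sup_{\|f\|_H\le1}\|f-S_n(f)\|_2$,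 infimum over all $S_n(f)=\sum_{i=1}^nf_{x_i}g_i$ with $x_i\in\mathbb{N}$ and $g_i\in\ell_2$; - $e_n(H,\mathrm{INT}_h)=\inf_{Q_n}\sup_{\|f\|_H\le1}|\mathrm{INT}_h(f)-Q_n(f)|$, infimum over all $Q_n(f)=\sum_{i=1}^nw_if_{x_i}$ with $w_i\in\mathbb{R}$, $x_i\in\mathbb{N}$. *)

theory Defs
  imports "HOL-Analysis.Analysis"
begin

text \<open>Sequences are functions on \<^typ>\<open>nat\<close>, so the domain \<open>{1, 2, \<dots>}\<close> of
  \<open>\<ell>\<^sub>2\<close> is relabelled as \<open>{0, 1, \<dots>}\<close>. The use of \<^const>\<open>infsum\<close> rather than \<^const>\<open>suminf\<close>
  makes the norm nonnegative (namely 0) also outside \<open>\<ell>\<^sub>2\<close>, as the locale \<^locale>\<open>Metric_space\<close>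
  demands of a distance; on \<open>\<ell>\<^sub>2\<close> there is no difference.\<close>

definition l2 :: "(nat \<Rightarrow> real) set" where
  "l2 = {f. summable (\<lambda>j. (f j)\<^sup>2)}"

definition l2_norm :: "(nat \<Rightarrow> real) \<Rightarrow> real" where
  "l2_norm f = sqrt (\<Sum>\<^sub>\<infinity>j. (f j)\<^sup>2)"

definition l2_dist :: "(nat \<Rightarrow> real) \<Rightarrow> (nat \<Rightarrow> real) \<Rightarrow> real" where
  "l2_dist f g = l2_norm (\<lambda>j. f j - g j)"

lemma l2_norm_eq_suminf:
  assumes "f \<in> l2"
  shows "l2_norm f = sqrt (\<Sum>j. (f j)\<^sup>2)"
proof -
  have "(\<lambda>j. (f j)\<^sup>2) summable_on UNIV"
    using assms by (simp add: l2_def summable_on_UNIV_nonneg_real_iff)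
  then have "(\<lambda>j. (f j)\<^sup>2) sums (\<Sum>\<^sub>\<infinity>j. (f j)\<^sup>2)"
    by (intro has_sum_imp_sums has_sum_infsum)
  then show ?thesis
    by (simp add: l2_norm_def sums_unique)
qed

lemma l2_norm_limit:
  assumes "f \<in> l2"
  shows "(\<lambda>n. L2_set f {..<n}) \<longlonglongrightarrow> l2_norm f"
proof -
  have "(\<lambda>n. \<Sum>j<n. (f j)\<^sup>2) \<longlonglongrightarrow> (\<Sum>j. (f j)\<^sup>2)"
    using assms by (simp add: l2_def summable_LIMSEQ)
  then show ?thesis
    unfolding L2_set_def l2_norm_eq_suminf[OF assms] by (rule tendsto_real_sqrt)
qed

lemma l2_diff: "(\<lambda>j. f j - g j) \<in> l2" if "f \<in> l2" "g \<in> l2"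
proof -
  have "summable (\<lambda>j. 2 * (f j)\<^sup>2 + 2 * (g j)\<^sup>2)"
    using that by (intro summable_add summable_mult) (auto simp: l2_def)
  moreover have "norm ((a - b)\<^sup>2) \<le> 2 * a\<^sup>2 + 2 * b\<^sup>2" for a b :: real
  proof -
    have "(a - b)\<^sup>2 + (a + b)\<^sup>2 = 2 * a\<^sup>2 + 2 * b\<^sup>2"
      by (simp add: power2_eq_square algebra_simps)
    then show ?thesis
      using zero_le_power2[of "a + b"] unfolding real_norm_def abs_power2 by linarith
  qed
  ultimately show ?thesis
    unfolding l2_def mem_Collect_eq by (rule summable_comparison_test'[where N = 0])
qed

lemma Metric_space_l2: "Metric_space l2 l2_dist"
proof
  show "0 \<le> l2_dist f g" for f g
    by (simp add: l2_dist_def l2_norm_def infsum_nonneg)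
  show "l2_dist f g = l2_dist g f" for f g
    by (simp add: l2_dist_def l2_norm_def power2_commute)
  show "l2_dist f g = 0 \<longleftrightarrow> f = g" if "f \<in> l2" "g \<in> l2" for f g
    using l2_diff[OF that]
    by (auto simp: l2_dist_def l2_norm_eq_suminf l2_def suminf_eq_zero_iff)
  show "l2_dist f k \<le> l2_dist f g + l2_dist g k" if "f \<in> l2" "g \<in> l2" "k \<in> l2" for f g k
    unfolding l2_dist_def
  proof (rule LIMSEQ_le)
    show "(\<lambda>n. L2_set (\<lambda>j. f j - k j) {..<n}) \<longlonglongrightarrow> l2_norm (\<lambda>j. f j - k j)"
      using that by (intro l2_norm_limit l2_diff)
    show "(\<lambda>n. L2_set (\<lambda>j. f j - g j) {..<n} + L2_set (\<lambda>j. g j - k j) {..<n})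
      \<longlonglongrightarrow> l2_norm (\<lambda>j. f j - g j) + l2_norm (\<lambda>j. g j - k j)"
      using that by (intro tendsto_add l2_norm_limit l2_diff)
    show "\<exists>N. \<forall>n\<ge>N. L2_set (\<lambda>j. f j - k j) {..<n}
      \<le> L2_set (\<lambda>j. f j - g j) {..<n} + L2_set (\<lambda>j. g j - k j) {..<n}"
      using L2_set_triangle_ineq[of "\<lambda>j. f j - g j" "\<lambda>j. g j - k j"] by simp
  qed
qed

definition l2_topology :: "(nat \<Rightarrow> real) topology" where
  "l2_topology = Metric_space.mtopology l2 l2_dist"

text \<open>A Hilbert space inside \<open>\<ell>\<^sub>2\<close> is a pair of a carrier \<open>H\<close> and an inner product \<open>ip\<close>,
  whose values outside \<open>H\<close> are irrelevant.\<close>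

definition hnorm :: "((nat \<Rightarrow> real) \<Rightarrow> (nat \<Rightarrow> real) \<Rightarrow> real) \<Rightarrow> (nat \<Rightarrow> real) \<Rightarrow> real" where
  "hnorm ip f = sqrt (ip f f)"

locale hilbert_space_in_l2 =
  fixes H :: "(nat \<Rightarrow> real) set"
    and ip :: "(nat \<Rightarrow> real) \<Rightarrow> (nat \<Rightarrow> real) \<Rightarrow> real"
  assumes subset_l2: "H \<subseteq> l2"
    and zero_mem: "(\<lambda>j. 0) \<in> H"
    and add_mem: "\<And>f g. f \<in> H \<Longrightarrow> g \<in> H \<Longrightarrow> (\<lambda>j. f j + g j) \<in> H"
    and scale_mem: "\<And>c f. f \<in> H \<Longrightarrow> (\<lambda>j. c * f j) \<in> H"
    and ip_commute: "\<And>f g. f \<in> H \<Longrightarrow> g \<in> H \<Longrightarrow> ip f g = ip g f"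
    and ip_add: "\<And>f g k. f \<in> H \<Longrightarrow> g \<in> H \<Longrightarrow> k \<in> H \<Longrightarrow>
      ip (\<lambda>j. f j + g j) k = ip f k + ip g k"
    and ip_scale: "\<And>c f g. f \<in> H \<Longrightarrow> g \<in> H \<Longrightarrow> ip (\<lambda>j. c * f j) g = c * ip f g"
    and ip_nonneg: "\<And>f. f \<in> H \<Longrightarrow> 0 \<le> ip f f"
    and ip_definite: "\<And>f. f \<in> H \<Longrightarrow> ip f f = 0 \<Longrightarrow> f = (\<lambda>j. 0)"
    and complete: "Metric_space.mcomplete H (\<lambda>f g. hnorm ip (\<lambda>j. f j - g j))"
    and continuous_inclusion: "\<exists>C. \<forall>f\<in>H. l2_norm f \<le> C * hnorm ip f"

definition unit_ball ::
  "(nat \<Rightarrow> real) set \<Rightarrow> ((nat \<Rightarrow> real) \<Rightarrow> (nat \<Rightarrow> real) \<Rightarrow> real) \<Rightarrow> (nat \<Rightarrow> real) set" where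
  "unit_ball H ip = {f \<in> H. hnorm ip f \<le> 1}"

definition compactly_embedded ::
  "(nat \<Rightarrow> real) set \<Rightarrow> ((nat \<Rightarrow> real) \<Rightarrow> (nat \<Rightarrow> real) \<Rightarrow> real) \<Rightarrow> bool" where
  "compactly_embedded H ip \<longleftrightarrow> compactin l2_topology (l2_topology closure_of unit_ball H ip)"

definition linear_functional_on :: "(nat \<Rightarrow> real) set \<Rightarrow> ((nat \<Rightarrow> real) \<Rightarrow> real) \<Rightarrow> bool" where
  "linear_functional_on H L \<longleftrightarrow>
     (\<forall>f\<in>H. \<forall>g\<in>H. L (\<lambda>j. f j + g j) = L f + L g) \<and>
     (\<forall>c. \<forall>f\<in>H. L (\<lambda>j. c * f j) = c * L f)"

text \<open>The worst-case errors take values in \<^typ>\<open>ennreal\<close>, because the functionals \<open>L i\<close> need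
  not be bounded and so the supremum may be infinite.\<close>

definition approx_number ::
  "(nat \<Rightarrow> real) set \<Rightarrow> ((nat \<Rightarrow> real) \<Rightarrow> (nat \<Rightarrow> real) \<Rightarrow> real) \<Rightarrow> nat \<Rightarrow> ennreal" where
  "approx_number H ip n =
     (INF (L, g) \<in> {(L :: nat \<Rightarrow> (nat \<Rightarrow> real) \<Rightarrow> real, g :: nat \<Rightarrow> nat \<Rightarrow> real).
          \<forall>i<n. linear_functional_on H (L i) \<and> g i \<in> l2}.
        SUP f \<in> unit_ball H ip. ennreal (l2_norm (\<lambda>j. f j - (\<Sum>i<n. L i f * g i j))))"

definition sampling_number ::
  "(nat \<Rightarrow> real) set \<Rightarrow> ((nat \<Rightarrow> real) \<Rightarrow> (nat \<Rightarrow> real) \<Rightarrow> real) \<Rightarrow> nat \<Rightarrow> ennreal" where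
  "sampling_number H ip n =
     (INF (x, g) \<in> {(x :: nat \<Rightarrow> nat, g :: nat \<Rightarrow> nat \<Rightarrow> real). \<forall>i<n. g i \<in> l2}.
        SUP f \<in> unit_ball H ip. ennreal (l2_norm (\<lambda>j. f j - (\<Sum>i<n. f (x i) * g i j))))"

definition l2_integral :: "(nat \<Rightarrow> real) \<Rightarrow> (nat \<Rightarrow> real) \<Rightarrow> real" where
  "l2_integral h f = (\<Sum>j. h j * f j)"

definition integration_error ::
  "(nat \<Rightarrow> real) set \<Rightarrow> ((nat \<Rightarrow> real) \<Rightarrow> (nat \<Rightarrow> real) \<Rightarrow> real) \<Rightarrow> (nat \<Rightarrow> real) \<Rightarrow> nat \<Rightarrow> ennreal" where
  "integration_error H ip h n =
     (INF (x, w) \<in> (UNIV :: ((nat \<Rightarrow> nat) \<times> (nat \<Rightarrow> real)) set).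
        SUP f \<in> unit_ball H ip. ennreal \<bar>l2_integral h f - (\<Sum>i<n. w i * f (x i))\<bar>)"

end

theory Submission imports Defs begin

text \<open>
  Write \<open>s\<^sub>k = \<sigma>\<^sub>k\<^sub>+\<^sub>1\<close>. The unit ball of \<open>H\<close> is the image of the ellipsoid with semi-axes \<open>s\<^sub>k\<close> under an
  orthogonal involution \<open>U\<close> of \<open>\<ell>\<^sub>2\<close>, so only the choice of \<open>U\<close> and \<open>h\<close> matters for the integration
  error. The coordinates are split into finite blocks; the block number \<open>b\<close> consists of a top
  coordinate \<open>t = 2 b + 1\<close>, fixed in advance, and of a finite set \<open>F\<close> of even coordinates. On each
  block \<open>U\<close> is the reflection that exchanges \<open>e\<^sub>t\<close> with the unit vector \<open>u\<close> on \<open>F\<close> whose entries are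
  \<open>s\<^sub>x / \<surd>A\<close>, where \<open>A\<close> is the sum of the \<open>s\<^sub>x\<^sup>2\<close> over \<open>F\<close>. Thus \<open>u\<close> has norm \<open>1 / s\<^sub>t\<close> in \<open>H\<close>. Making \<open>u\<close>
  vanish at \<open>n\<close> given points while keeping its inner product with itself costs only \<open>O(1/A)\<close> in the
  squared norm, with a constant that depends on \<open>n\<close> and on the first few coordinates in \<open>F\<close>.
  Since the sum of the \<open>s\<^sub>x\<^sup>2\<close> over even \<open>x\<close> diverges, \<open>A\<close> can be made as large as necessary.
  Take \<open>h\<close> to be the sum of the vectors \<open>c\<^sub>b u\<^sub>b\<close> with \<open>c\<^sub>b\<^sup>2 = 2\<^sup>-\<^sup>b\<^sup>-\<^sup>1\<close>. Then the error is at least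
  \<open>c\<^sub>b s\<^sub>t / \<surd>2\<close> for all \<open>n\<close> up to a bound that is at our disposal. As this value does not depend on the
  size of the blocks, the bound can be chosen so large that \<open>\<tau>\<close> has already dropped below the
  error belonging to the next block.
\<close>

section \<open>The space of square summable sequences\<close>


lemma l2_norm_nonneg: "0 \<le> l2_norm f"
  by (simp add: l2_norm_def infsum_nonneg)

lemma L2_set_le_l2_norm:
  assumes "f \<in> l2" "finite F"
  shows "L2_set f F \<le> l2_norm f"
  unfolding L2_set_def l2_norm_eq_suminf[OF assms(1)]
  using assms by (intro real_sqrt_le_mono sum_le_suminf) (auto simp: l2_def)

text \<open>Bounds on finite sections suffice, which lets coordinatewise limits and blockwise
  estimates carry over to \<open>l2\<close>.\<close>

lemma
  assumes "\<And>n. L2_set f {..<n} \<le> B"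
  shows l2_if_bounded: "f \<in> l2" and l2_norm_le: "l2_norm f \<le> B"
proof -
  have B: "0 \<le> B"
    using assms[of 0] by simp
  have "(\<Sum>j<n. (f j)\<^sup>2) \<le> B\<^sup>2" for n
    using assms[of n] by (simp add: L2_set_def real_sqrt_le_iff real_le_lsqrt sqrt_le_D)
  then have "summable (\<lambda>j. (f j)\<^sup>2)"
    by (intro bounded_imp_summable[where B = "B\<^sup>2"]) (auto simp: lessThan_Suc_atMost[symmetric] simp del: sum.lessThan_Suc)
  then show "f \<in> l2"
    by (simp add: l2_def)
  then show "l2_norm f \<le> B"
    using assms by (intro LIMSEQ_le_const2[OF l2_norm_limit]) auto
qed

lemma
  assumes "finite F" "\<And>j. j \<notin> F \<Longrightarrow> f j = 0"
  shows l2_if_finite_support: "f \<in> l2" and l2_norm_finite_support: "l2_norm f = L2_set f F"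
proof -
  show *: "f \<in> l2"
    unfolding l2_def mem_Collect_eq using assms by (intro summable_finite[of F]) auto
  show "l2_norm f = L2_set f F"
    unfolding l2_norm_eq_suminf[OF *] L2_set_def using assms
    by (subst suminf_finite[of F]) auto
qed

lemma l2_zero: "(\<lambda>j. 0) \<in> l2"
  by (simp add: l2_def)

lemma l2_scale: "f \<in> l2 \<Longrightarrow> (\<lambda>j. c * f j) \<in> l2"
  unfolding l2_def by (simp add: power_mult_distrib summable_mult)

lemma l2_add: "f \<in> l2 \<Longrightarrow> g \<in> l2 \<Longrightarrow> (\<lambda>j. f j + g j) \<in> l2"
  using l2_diff[of f "\<lambda>j. - 1 * g j"] l2_scale[of g "- 1"] by simp

lemma l2_sum:
  fixes n :: nat
  assumes "\<And>i. i < n \<Longrightarrow> g i \<in> l2"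
  shows "(\<lambda>j. \<Sum>i<n. c i * g i j) \<in> l2"
  using assms by (induction n) (auto intro!: l2_zero l2_add l2_scale)

lemma l2_norm_scale:
  assumes "f \<in> l2"
  shows "l2_norm (\<lambda>j. c * f j) = \<bar>c\<bar> * l2_norm f"
proof -
  have "(\<Sum>j. (c * f j)\<^sup>2) = c\<^sup>2 * (\<Sum>j. (f j)\<^sup>2)"
    using assms by (simp add: power_mult_distrib suminf_mult l2_def)
  then show ?thesis
    using assms by (simp add: l2_norm_eq_suminf l2_scale real_sqrt_mult)
qed

lemma l2_norm_zero_iff: "f \<in> l2 \<Longrightarrow> l2_norm f = 0 \<longleftrightarrow> f = (\<lambda>j. 0)"
  by (auto simp: l2_norm_eq_suminf l2_def suminf_eq_zero_iff)

lemma
  assumes "f \<in> l2" "g \<in> l2"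
  shows l2_summable_mult: "summable (\<lambda>j. f j * g j)"
    and l2_Cauchy_Schwarz: "\<bar>\<Sum>j. f j * g j\<bar> \<le> l2_norm f * l2_norm g"
proof -
  have *: "(\<Sum>j<n. \<bar>f j * g j\<bar>) \<le> l2_norm f * l2_norm g" for n
  proof -
    have "(\<Sum>j<n. \<bar>f j * g j\<bar>) \<le> L2_set f {..<n} * L2_set g {..<n}"
      using L2_set_mult_ineq[of f g "{..<n}"] by (simp add: abs_mult)
    also have "\<dots> \<le> l2_norm f * l2_norm g"
      using assms by (intro mult_mono L2_set_le_l2_norm) (auto simp: l2_norm_nonneg)
    finally show ?thesis .
  qed
  then have s: "summable (\<lambda>j. \<bar>f j * g j\<bar>)"
    by (intro bounded_imp_summable[where B = "l2_norm f * l2_norm g"])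
      (auto simp: lessThan_Suc_atMost[symmetric] simp del: sum.lessThan_Suc)
  then show "summable (\<lambda>j. f j * g j)"
    by (rule summable_rabs_cancel)
  have "\<bar>\<Sum>j. f j * g j\<bar> \<le> (\<Sum>j. \<bar>f j * g j\<bar>)"
    by (rule summable_rabs[OF s])
  also have "\<dots> \<le> l2_norm f * l2_norm g"
    by (rule suminf_le_const[OF s *])
  finally show "\<bar>\<Sum>j. f j * g j\<bar> \<le> l2_norm f * l2_norm g" .
qed

interpretation l2: Metric_space l2 l2_dist
  by (rule Metric_space_l2)

text \<open>The coordinates of a Cauchy sequence converge. On each finite section the Cauchy
  estimate survives the limit in one index, with a bound that does not depend on the
  section.\<close>

lemma mcomplete_l2: "l2.mcomplete"
  unfolding l2.mcomplete_def
proof (intro allI impI)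
  fix F :: "nat \<Rightarrow> nat \<Rightarrow> real"
  assume "l2.MCauchy F"
  then have F: "\<And>n. F n \<in> l2"
    and cau: "\<And>e. e > 0 \<Longrightarrow> \<exists>N. \<forall>m n. N \<le> m \<longrightarrow> N \<le> n \<longrightarrow> l2_dist (F m) (F n) < e"
    unfolding l2.MCauchy_def by auto
  have coord: "\<bar>F m k - F n k\<bar> \<le> l2_dist (F m) (F n)" for m n k
    using L2_set_le_l2_norm[OF l2_diff[OF F F], of "{k}" m n] by (simp add: l2_dist_def)
  have "Cauchy (\<lambda>n. F n k)" for k
    unfolding Cauchy_def dist_real_def using cau coord by (meson le_less_trans)
  then have "\<exists>l. (\<lambda>n. F n k) \<longlonglongrightarrow> l" for k
    using Cauchy_convergent convergent_def by blast
  then obtain G where G: "\<And>k. (\<lambda>n. F n k) \<longlonglongrightarrow> G k"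
    by metis
  have main: "\<exists>N. \<forall>n\<ge>N. (\<lambda>k. F n k - G k) \<in> l2 \<and> l2_norm (\<lambda>k. F n k - G k) \<le> e" if "e > 0" for e
  proof -
    from cau[OF that] obtain N where N: "\<And>m n. m \<ge> N \<Longrightarrow> n \<ge> N \<Longrightarrow> l2_dist (F m) (F n) < e"
      by blast
    have "L2_set (\<lambda>k. F n k - G k) {..<K} \<le> e" if "n \<ge> N" for n K
    proof (rule LIMSEQ_le_const2)
      show "(\<lambda>m. L2_set (\<lambda>k. F n k - F m k) {..<K}) \<longlonglongrightarrow> L2_set (\<lambda>k. F n k - G k) {..<K}"
        unfolding L2_set_def by (intro tendsto_intros G)
      show "\<exists>N. \<forall>m\<ge>N. L2_set (\<lambda>k. F n k - F m k) {..<K} \<le> e"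
      proof (intro exI allI impI)
        fix m assume "m \<ge> N"
        have "L2_set (\<lambda>k. F n k - F m k) {..<K} \<le> l2_dist (F n) (F m)"
          unfolding l2_dist_def using F by (intro L2_set_le_l2_norm l2_diff) auto
        also have "\<dots> \<le> e"
          using N[OF \<open>n \<ge> N\<close> \<open>m \<ge> N\<close>] by simp
        finally show "L2_set (\<lambda>k. F n k - F m k) {..<K} \<le> e" .
      qed
    qed
    then show ?thesis
      using l2_if_bounded l2_norm_le by blast
  qed
  obtain n where "(\<lambda>k. F n k - G k) \<in> l2"
    using main[of 1] by auto
  from l2_diff[OF F[of n] this] have "G \<in> l2"
    by simp
  have "\<exists>N. \<forall>n\<ge>N. F n \<in> l2 \<and> l2_dist (F n) G < e" if "e > 0" for e
  proof -
    have "e / 2 > 0" using that by simp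
    from main[OF this] obtain N where "\<forall>n\<ge>N. l2_norm (\<lambda>k. F n k - G k) \<le> e / 2"
      by blast
    then have "\<forall>n\<ge>N. l2_dist (F n) G < e"
      using that by (force simp: l2_dist_def)
    then show ?thesis using F by blast
  qed
  then have "limitin l2.mtopology F G sequentially"
    using \<open>G \<in> l2\<close> by (simp add: l2.limit_metric_sequentially)
  then show "\<exists>x. limitin l2.mtopology F x sequentially"
    by blast
qed


text \<open>Boundedness of diagonal operators. It serves for multiplication by \<open>s\<close>, for
  its tails and, on finitely many coordinates, for division by \<open>s\<close>.\<close>

lemma
  assumes "c \<in> l2" "\<And>k. \<bar>d k\<bar> \<le> a * \<bar>c k\<bar>" "0 \<le> a"
  shows l2_if_dominated: "d \<in> l2" and l2_norm_dominated: "l2_norm d \<le> a * l2_norm c"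
proof -
  have "L2_set d {..<n} \<le> a * l2_norm c" for n
  proof -
    have "L2_set d {..<n} = L2_set (\<lambda>k. \<bar>d k\<bar>) {..<n}"
      by (simp add: L2_set_def)
    also have "\<dots> \<le> L2_set (\<lambda>k. a * \<bar>c k\<bar>) {..<n}"
      using assms(2) by (intro L2_set_mono) auto
    also have "\<dots> = a * L2_set c {..<n}"
      using assms(3) by (simp add: L2_set_right_distrib) (simp add: L2_set_def power_mult_distrib)
    also have "\<dots> \<le> a * l2_norm c"
      using assms by (intro mult_left_mono L2_set_le_l2_norm) auto
    finally show ?thesis .
  qed
  then show "d \<in> l2" "l2_norm d \<le> a * l2_norm c"
    using l2_if_bounded l2_norm_le by blast+
qed

lemma l2_norm_minus: "l2_norm (\<lambda>j. - f j) = l2_norm f"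
  by (simp add: l2_norm_def)

lemma l2_norm_triangle:
  assumes "f \<in> l2" "g \<in> l2"
  shows "l2_norm (\<lambda>j. f j + g j) \<le> l2_norm f + l2_norm g"
proof -
  have "(\<lambda>j. - g j) \<in> l2" using l2_scale[OF assms(2), of "- 1"] by simp
  from l2.triangle[OF assms(1) l2_zero this] show ?thesis
    by (simp add: l2_dist_def)
qed

text \<open>Gaussian elimination for \<open>n\<close> homogeneous equations in \<open>n + 1\<close>
  unknowns, by induction on \<open>n\<close>. If the last equation is trivial, the new unknown is
  set to 0; otherwise a pivot in it eliminates one unknown from the others.\<close>

lemma underdetermined_system:
  fixes a :: "nat \<Rightarrow> nat \<Rightarrow> real"
  shows "\<exists>c. (\<exists>k\<le>n. c k \<noteq> 0) \<and> (\<forall>i<n. (\<Sum>k\<le>n. c k * a i k) = 0)"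
proof (induction n arbitrary: a)
  case 0
  show ?case by (intro exI[of _ "\<lambda>_. 1"]) auto
next
  case (Suc n)
  show ?case
  proof (cases "\<exists>p\<le>Suc n. a n p \<noteq> 0")
    case False
    from Suc[of a] obtain c where c: "\<exists>k\<le>n. c k \<noteq> 0" "\<forall>i<n. (\<Sum>k\<le>n. c k * a i k) = 0"
      by blast
    let ?c = "\<lambda>k. if k \<le> n then c k else 0"
    have "(\<Sum>k\<le>Suc n. ?c k * a i k) = 0" if "i < Suc n" for i
    proof (cases "i = n")
      case True
      then show ?thesis using False by (intro sum.neutral) auto
    next
      case False
      then show ?thesis using c(2) that by simp
    qed
    then show ?thesis using c(1) by (intro exI[of _ ?c]) auto
  next
    case True
    then obtain p where p: "p \<le> Suc n" "a n p \<noteq> 0" by blast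
    text \<open>Swap column \<open>p\<close> with the last one and eliminate it.\<close>
    define q where "q = Transposition.transpose p (Suc n)"
    define b where "b i k = a i (q k) - a i p / a n p * a n (q k)" for i k
    from Suc[of b] obtain c where c: "\<exists>k\<le>n. c k \<noteq> 0" "\<forall>i<n. (\<Sum>k\<le>n. c k * b i k) = 0"
      by blast
    define S where "S = (\<Sum>k\<le>n. c k * a n (q k))"
    \<comment> \<open>The pivot unknown is solved for in equation \<open>n\<close>, to which the
      other unknowns contribute \<open>S\<close>.\<close>
    define c' where "c' k = (if k \<le> n then c k else - S / a n p)" for k
    have q: "q (Suc n) = p" by (simp add: q_def)
    have bij: "bij_betw q {..Suc n} {..Suc n}"
      unfolding q_def using p(1) by (intro permutes_imp_bij permutes_swap_id) auto
    have qq: "q (q k) = k" for k by (simp add: q_def)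
    have sum: "(\<Sum>k\<le>Suc n. c' (q k) * a i k) = (\<Sum>k\<le>n. c k * a i (q k)) - S / a n p * a i p" for i
    proof -
      have "(\<Sum>k\<le>Suc n. c' (q k) * a i k) = (\<Sum>k\<le>Suc n. c' (q (q k)) * a i (q k))"
        by (rule sum.reindex_bij_betw[OF bij, symmetric])
      then show ?thesis by (simp add: qq q c'_def)
    qed
    have "(\<Sum>k\<le>Suc n. c' (q k) * a i k) = 0" if "i < Suc n" for i
    proof (cases "i = n")
      case True
      then show ?thesis using p(2) unfolding sum by (simp add: S_def)
    next
      case False
      then have "0 = (\<Sum>k\<le>n. c k * b i k)" using c(2) that by simp
      also have "\<dots> = (\<Sum>k\<le>n. c k * a i (q k)) - a i p / a n p * S"
        unfolding b_def S_def
        by (simp add: right_diff_distrib sum_subtractf sum_distrib_left algebra_simps)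
      finally show ?thesis unfolding sum by simp
    qed
    moreover obtain k where "k \<le> n" "c k \<noteq> 0" using c(1) by blast
    then have "q k \<le> Suc n \<and> c' (q (q k)) \<noteq> 0"
      using bij_betwE[OF bij] by (auto simp: qq c'_def)
    ultimately show ?thesis
      by (intro exI[of _ "\<lambda>k. c' (q k)"]) auto
  qed
qed

text \<open>Integrating a sampling operator against \<open>h\<close> gives a quadrature rule with
  weights \<open>l2_integral h (g i)\<close>. As \<open>h\<close> has norm 1, Cauchy-Schwarz bounds
  its error by that of the operator.\<close>

lemma integration_error_le_sampling_number:
  assumes "H \<subseteq> l2" "h \<in> l2" "l2_norm h = 1"
  shows "integration_error H ip h n \<le> sampling_number H ip n"
  unfolding sampling_number_def
proof (rule INF_greatest, clarsimp)
  fix x :: "nat \<Rightarrow> nat" and g :: "nat \<Rightarrow> nat \<Rightarrow> real"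
  assume g: "\<forall>i<n. g i \<in> l2"
  define w where "w i = l2_integral h (g i)" for i
  have "integration_error H ip h n
      \<le> (SUP f\<in>unit_ball H ip. ennreal \<bar>l2_integral h f - (\<Sum>i<n. w i * f (x i))\<bar>)"
    unfolding integration_error_def by (rule INF_lower2[of "(x, w)"]) auto
  also have "\<dots> \<le> (SUP f\<in>unit_ball H ip. ennreal (l2_norm (\<lambda>j. f j - (\<Sum>i<n. f (x i) * g i j))))"
  proof (rule SUP_mono, intro bexI ennreal_leI)
    fix f assume "f \<in> unit_ball H ip"
    then have f: "f \<in> l2" using assms(1) by (auto simp: unit_ball_def)
    have S: "(\<lambda>j. \<Sum>i<n. f (x i) * g i j) \<in> l2"
      using g by (intro l2_sum) auto
    have "(\<lambda>j. \<Sum>i<n. f (x i) * (h j * g i j)) sums (\<Sum>i<n. f (x i) * w i)"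
      unfolding w_def l2_integral_def
      using g assms(2) by (intro sums_sum sums_mult summable_sums l2_summable_mult) auto
    moreover have "(\<lambda>j. h j * f j) sums l2_integral h f"
      unfolding l2_integral_def using assms(2) f by (intro summable_sums l2_summable_mult)
    ultimately have "(\<lambda>j. h j * f j - (\<Sum>i<n. f (x i) * (h j * g i j))) sums
        (l2_integral h f - (\<Sum>i<n. f (x i) * w i))"
      by (intro sums_diff)
    moreover have "h j * f j - (\<Sum>i<n. f (x i) * (h j * g i j)) =
        h j * (f j - (\<Sum>i<n. f (x i) * g i j))" for j
      by (simp add: right_diff_distrib sum_distrib_left mult.left_commute)
    ultimately have "l2_integral h f - (\<Sum>i<n. w i * f (x i)) =
        (\<Sum>j. h j * (f j - (\<Sum>i<n. f (x i) * g i j)))"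
      by (simp add: sums_iff mult.commute)
    then show "\<bar>l2_integral h f - (\<Sum>i<n. w i * f (x i))\<bar>
        \<le> l2_norm (\<lambda>j. f j - (\<Sum>i<n. f (x i) * g i j))"
      using l2_Cauchy_Schwarz[OF assms(2) l2_diff[OF f S]] assms(3) by simp
  qed auto
  finally show "integration_error H ip h n
      \<le> (SUP f\<in>unit_ball H ip. ennreal (l2_norm (\<lambda>j. f j - (\<Sum>i<n. f (x i) * g i j))))" .
qed

section \<open>Ellipsoids with prescribed semi-axes\<close>

text \<open>\<open>U\<close> stays abstract because the Hilbert space structure, compactness and the
  approximation numbers come out the same for every such rotation; its concrete form matters only
  for function values.\<close>

locale rotated_ellipsoid =
  fixes U :: "(nat \<Rightarrow> real) \<Rightarrow> nat \<Rightarrow> real" and s :: "nat \<Rightarrow> real"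
  assumes U_add: "U (\<lambda>j. f j + g j) = (\<lambda>j. U f j + U g j)"
    and U_scale: "U (\<lambda>j. c * f j) = (\<lambda>j. c * U f j)"
    and U_involution: "U (U f) = f"
    and U_l2: "f \<in> l2 \<Longrightarrow> U f \<in> l2"
    and U_norm: "f \<in> l2 \<Longrightarrow> l2_norm (U f) = l2_norm f"
    and s_pos: "0 < s k"
    and s_decseq: "decseq s"
    and s_limit: "s \<longlonglongrightarrow> 0"
begin

text \<open>The coordinates of \<open>f\<close> in the basis of the vectors \<open>U (e k)\<close>
  scaled by \<open>s k\<close>, with \<open>e k\<close> the unit vectors. This basis is orthonormal
  for \<open>ip\<close>, so \<open>coef\<close> is an isometry of \<open>space\<close> onto
  \<open>l2\<close>, with inverse \<open>synth\<close>.\<close>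

definition coef :: "(nat \<Rightarrow> real) \<Rightarrow> nat \<Rightarrow> real" where
  "coef f k = U f k / s k"

definition synth :: "(nat \<Rightarrow> real) \<Rightarrow> nat \<Rightarrow> real" where
  "synth c = U (\<lambda>k. s k * c k)"

definition space :: "(nat \<Rightarrow> real) set" where
  "space = {f. coef f \<in> l2}"

text \<open>The value 0 outside \<open>space\<close> makes \<open>hnorm ip\<close> nonnegative and even on all sequences, as
  \<^locale>\<open>Metric_space\<close> demands.\<close>

definition ip :: "(nat \<Rightarrow> real) \<Rightarrow> (nat \<Rightarrow> real) \<Rightarrow> real" where
  "ip f g = (if f \<in> space \<and> g \<in> space then \<Sum>k. coef f k * coef g k else 0)"

lemma s_le: "m \<le> n \<Longrightarrow> s n \<le> s m"
  using s_decseq by (simp add: decseq_def)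

lemma U_diff: "U (\<lambda>j. f j - g j) = (\<lambda>j. U f j - U g j)"
  using U_add[of f "\<lambda>j. - 1 * g j"] U_scale[of "- 1" g] by simp

lemma U_sum: "U (\<lambda>j. \<Sum>i<(n::nat). c i * g i j) = (\<lambda>j. \<Sum>i<n. c i * U (g i) j)"
proof (induction n)
  case 0
  show ?case using U_scale[of 0 "\<lambda>_. 0"] by simp
next
  case (Suc n)
  then show ?case by (simp add: U_add U_scale)
qed

lemma coef_add: "coef (\<lambda>j. f j + g j) = (\<lambda>k. coef f k + coef g k)"
  by (simp add: coef_def U_add add_divide_distrib fun_eq_iff)

lemma coef_diff: "coef (\<lambda>j. f j - g j) = (\<lambda>k. coef f k - coef g k)"
  by (simp add: coef_def U_diff diff_divide_distrib fun_eq_iff)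

lemma coef_scale: "coef (\<lambda>j. c * f j) = (\<lambda>k. c * coef f k)"
  by (simp add: coef_def U_scale fun_eq_iff)

lemma s_coef: "s k * coef f k = U f k"
  using s_pos[of k] by (simp add: coef_def)

lemma coef_synth: "coef (synth c) = c"
  using s_pos by (auto simp: coef_def synth_def U_involution fun_eq_iff less_le)

lemma synth_coef: "synth (coef f) = f"
  by (simp add: synth_def s_coef U_involution)

lemma coef_zero: "coef (\<lambda>j. 0) = (\<lambda>k. 0)"
  using coef_scale[of 0 "\<lambda>_. 0"] by simp

lemma synth_zero: "synth (\<lambda>k. 0) = (\<lambda>j. 0)"
  using synth_coef[of "\<lambda>j. 0"] by (simp add: coef_zero)

lemma synth_mem: "c \<in> l2 \<Longrightarrow> synth c \<in> space"
  by (simp add: space_def coef_synth)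

lemma hnorm_eq: "f \<in> space \<Longrightarrow> hnorm ip f = l2_norm (coef f)"
  by (simp add: space_def hnorm_def ip_def l2_norm_eq_suminf power2_eq_square)

text \<open>\<open>U\<close> preserves the norm, and multiplication by the decreasing
  \<open>s\<close> has norm at most \<open>s 0\<close>.\<close>

lemma space_l2: "f \<in> space \<Longrightarrow> f \<in> l2"
  and space_norm_le: "f \<in> space \<Longrightarrow> l2_norm f \<le> s 0 * hnorm ip f"
proof -
  assume f: "f \<in> space"
  have *: "\<bar>U f k\<bar> \<le> s 0 * \<bar>coef f k\<bar>" for k
    using s_le[of 0 k] s_pos[of k] by (simp add: s_coef[symmetric] abs_mult mult_right_mono)
  have U: "U f \<in> l2"
    using f s_pos[of 0] by (intro l2_if_dominated[OF _ *]) (auto simp: space_def)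
  then show "f \<in> l2"
    using U_l2[OF U] by (simp add: U_involution)
  then show "l2_norm f \<le> s 0 * hnorm ip f"
    using f s_pos[of 0] U_norm[of f] l2_norm_dominated[of "coef f" "U f", OF _ *] hnorm_eq[OF f]
    by (auto simp: space_def)
qed

lemma space_diff: "f \<in> space \<Longrightarrow> g \<in> space \<Longrightarrow> (\<lambda>j. f j - g j) \<in> space"
  by (simp add: space_def coef_diff l2_diff)

lemma hnorm_diff: "f \<in> space \<Longrightarrow> g \<in> space \<Longrightarrow>
  hnorm ip (\<lambda>j. f j - g j) = l2_dist (coef f) (coef g)"
  by (simp add: hnorm_eq space_diff coef_diff l2_dist_def)

lemma hnorm_nonneg: "0 \<le> hnorm ip f"
  by (cases "f \<in> space") (simp_all add: hnorm_eq l2_norm_nonneg, simp add: hnorm_def ip_def)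

text \<open>\<open>Metric_space\<close> asks for symmetry on all sequences, so it must also be
  checked that the two differences lie in \<open>space\<close> together.\<close>

lemma hnorm_diff_commute: "hnorm ip (\<lambda>j. f j - g j) = hnorm ip (\<lambda>j. g j - f j)"
proof -
  have "coef (\<lambda>j. g j - f j) = (\<lambda>k. - 1 * coef (\<lambda>j. f j - g j) k)"
    by (simp add: coef_diff)
  moreover from this have "(\<lambda>j. g j - f j) \<in> space \<longleftrightarrow> (\<lambda>j. f j - g j) \<in> space"
    using l2_scale[of "coef (\<lambda>j. f j - g j)" "- 1"] l2_scale[of "coef (\<lambda>j. g j - f j)" "- 1"]
    by (auto simp: space_def coef_diff)
  ultimately show ?thesis
    by (simp add: hnorm_def ip_def coef_diff power2_eq_square[symmetric] power2_commute)
qed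

section \<open>Completeness and the Hilbert space axioms\<close>

lemma Metric_space_space: "Metric_space space (\<lambda>f g. hnorm ip (\<lambda>j. f j - g j))"
proof
  fix f g k
  show "0 \<le> hnorm ip (\<lambda>j. f j - g j)"
    by (rule hnorm_nonneg)
  show "hnorm ip (\<lambda>j. f j - g j) = hnorm ip (\<lambda>j. g j - f j)"
    by (rule hnorm_diff_commute)
  assume fg: "f \<in> space" "g \<in> space"
  then show "hnorm ip (\<lambda>j. f j - g j) = 0 \<longleftrightarrow> f = g"
    using l2.zero[of "coef f" "coef g"] synth_coef
    by (auto simp: hnorm_diff space_def) (metis synth_coef)
  assume "k \<in> space"
  with fg show "hnorm ip (\<lambda>j. f j - k j) \<le> hnorm ip (\<lambda>j. f j - g j) + hnorm ip (\<lambda>j. g j - k j)"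
    using l2.triangle[of "coef f" "coef g" "coef k"] by (auto simp: hnorm_diff space_def)
qed

text \<open>Completeness is transported from \<open>l2\<close> along the isometry
  \<open>coef\<close>.\<close>

lemma mcomplete_space: "Metric_space.mcomplete space (\<lambda>f g. hnorm ip (\<lambda>j. f j - g j))"
proof -
  interpret H: Metric_space space "\<lambda>f g. hnorm ip (\<lambda>j. f j - g j)"
    by (rule Metric_space_space)
  show ?thesis
    unfolding H.mcomplete_def
  proof (intro allI impI)
    fix F assume "H.MCauchy F"
    then have F: "\<And>n. F n \<in> space"
      and cau: "\<And>e. e > 0 \<Longrightarrow> \<exists>N. \<forall>m n. N \<le> m \<longrightarrow> N \<le> n \<longrightarrow> hnorm ip (\<lambda>j. F m j - F n j) < e"
      unfolding H.MCauchy_def by auto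
    have "l2.MCauchy (\<lambda>n. coef (F n))"
      unfolding l2.MCauchy_def using F cau by (auto simp: hnorm_diff) (auto simp: space_def)
    then obtain c where c: "limitin l2.mtopology (\<lambda>n. coef (F n)) c sequentially"
      using mcomplete_l2 unfolding l2.mcomplete_def by blast
    then have "c \<in> l2"
      by (simp add: l2.limit_metric_sequentially)
    with c F have "limitin H.mtopology F (synth c) sequentially"
      unfolding l2.limit_metric_sequentially H.limit_metric_sequentially
      by (simp add: hnorm_diff synth_mem coef_synth) meson
    then show "\<exists>f. limitin H.mtopology F f sequentially"
      by blast
  qed
qed

lemma hilbert_space: "hilbert_space_in_l2 space ip"
proof
  fix f g k and c :: real
  show "space \<subseteq> l2"
    using space_l2 by blast
  show zero: "(\<lambda>j. 0) \<in> space"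
    by (simp add: space_def coef_zero l2_zero)
  show "Metric_space.mcomplete space (\<lambda>f g. hnorm ip (\<lambda>j. f j - g j))"
    by (rule mcomplete_space)
  show "\<exists>C. \<forall>f\<in>space. l2_norm f \<le> C * hnorm ip f"
    using space_norm_le by blast
  assume f: "f \<in> space"
  show cf: "(\<lambda>j. c * f j) \<in> space"
    using f by (simp add: space_def coef_scale l2_scale)
  show "0 \<le> ip f f"
    using f by (simp add: ip_def space_def l2_def suminf_nonneg power2_eq_square)
  show "ip f f = 0 \<Longrightarrow> f = (\<lambda>j. 0)"
    using hnorm_eq[OF f] l2_norm_zero_iff[of "coef f"] f synth_coef[of f]
    by (auto simp: hnorm_def space_def synth_zero)
  assume g: "g \<in> space"
  show fg: "(\<lambda>j. f j + g j) \<in> space"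
    using f g by (simp add: space_def coef_add l2_add)
  show "ip f g = ip g f"
    using f g by (simp add: ip_def mult.commute)
  show "ip (\<lambda>j. c * f j) g = c * ip f g"
    using f g cf by (simp add: ip_def coef_scale mult.assoc suminf_mult l2_summable_mult space_def)
  assume k: "k \<in> space"
  show "ip (\<lambda>j. f j + g j) k = ip f k + ip g k"
    using f g k fg by (simp add: ip_def coef_add distrib_right suminf_add l2_summable_mult space_def)
qed

text \<open>Points of the ball have coordinates in a compact cube, so every sequence has a
  subsequence converging coordinatewise to a point of the ball. Since \<open>s\<close> tends to 0,
  tails are uniformly small and the convergence holds in norm. The ball is thus compact and equals
  its closure.\<close>

lemma compact_embedding: "compactly_embedded space ip"
proof -
  let ?B = "unit_ball space ip"
  have ball: "coef f \<in> l2" "l2_norm (coef f) \<le> 1" if "f \<in> ?B" for f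
    using that by (auto simp: unit_ball_def hnorm_eq) (simp add: space_def)
  have "compactin l2.mtopology ?B"
    unfolding l2.compactin_sequentially
  proof (intro conjI allI impI)
    show "?B \<subseteq> l2"
      by (auto simp: unit_ball_def space_l2)
    fix F :: "nat \<Rightarrow> nat \<Rightarrow> real"
    assume "range F \<subseteq> ?B"
    then have F: "F n \<in> ?B" for n
      by blast
    let ?K = "PiE UNIV (\<lambda>_. {-1..1}) :: (nat \<Rightarrow> real) set"
    have "compactin (product_topology (\<lambda>_. euclidean) UNIV) ?K"
      by (simp add: compactin_PiE)
    then have "seq_compact ?K"
      by (simp add: euclidean_product_topology compact_imp_seq_compact)
    moreover have "coef (F n) \<in> ?K" for n
    proof -
      have "\<bar>coef (F n) k\<bar> \<le> 1" for k
        using L2_set_le_l2_norm[OF ball(1)[OF F], of "{k}" n] ball(2)[OF F, of n] by simp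
      then show ?thesis by (auto simp: abs_le_iff minus_le_iff)
    qed
    ultimately obtain c r where r: "strict_mono (r :: nat \<Rightarrow> nat)"
      and lim: "((\<lambda>n. coef (F n)) \<circ> r) \<longlonglongrightarrow> c"
      unfolding seq_compact_def by metis
    have c: "(\<lambda>n. coef (F (r n)) k) \<longlonglongrightarrow> c k" for k
    proof -
      have "isCont (\<lambda>x :: nat \<Rightarrow> real. x k) c"
        by (rule continuous_on_interior[OF continuous_on_product_coordinates]) simp
      from isCont_tendsto_compose[OF this lim] show ?thesis
        by simp
    qed
    have "L2_set c {..<K} \<le> 1" for K
    proof (rule LIMSEQ_le_const2)
      show "(\<lambda>n. L2_set (coef (F (r n))) {..<K}) \<longlonglongrightarrow> L2_set c {..<K}"
        unfolding L2_set_def by (intro tendsto_intros c)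
      show "\<exists>N. \<forall>n\<ge>N. L2_set (coef (F (r n))) {..<K} \<le> 1"
        using L2_set_le_l2_norm[OF ball(1)[OF F]] ball(2)[OF F]
        by (meson finite_lessThan order_trans)
    qed
    then have c_l2: "c \<in> l2" "l2_norm c \<le> 1"
      using l2_if_bounded l2_norm_le by blast+
    then have mem: "synth c \<in> ?B"
      by (simp add: unit_ball_def synth_mem hnorm_eq coef_synth)
    have "\<exists>N. \<forall>n\<ge>N. l2_dist (F (r n)) (synth c) < e" if "e > 0" for e
    proof -
      \<comment> \<open>The factor 2 bounds the distance of two points of the unit ball of
        \<open>l2\<close>; the cut \<open>m\<close> makes everything beyond it smaller than
        \<open>e / 2\<close>.\<close>
      have "(\<lambda>m. s m * 2) \<longlonglongrightarrow> 0"
        using tendsto_mult_left_zero[OF s_limit] by simp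
      from order_tendstoD(2)[OF this, of "e / 2"] obtain m where m: "s m * 2 < e / 2"
        using \<open>e > 0\<close> by (auto simp: eventually_sequentially)
      let ?d = "\<lambda>n k. coef (F (r n)) k - c k"
      have d: "?d n \<in> l2" "l2_norm (?d n) \<le> 2" for n
      proof -
        show "?d n \<in> l2" using ball(1)[OF F] c_l2 by (intro l2_diff)
        show "l2_norm (?d n) \<le> 2"
          using l2.triangle[OF ball(1)[OF F[of "r n"]] l2_zero c_l2(1)] ball(2)[OF F[of "r n"]] c_l2(2)
          by (simp add: l2_dist_def l2_norm_minus)
      qed
      \<comment> \<open>The image of the difference under \<open>U\<close> is split into a head
        \<open>x\<close>, which tends to 0 coordinatewise, and a tail \<open>y\<close>, bounded by
        \<open>s m * 2\<close> for all \<open>n\<close>.\<close>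
      define x where "x n k = (if k < m then s k * ?d n k else 0)" for n k
      define y where "y n k = (if k < m then 0 else s k * ?d n k)" for n k
      have x: "x n \<in> l2" "l2_norm (x n) = L2_set (\<lambda>k. s k * ?d n k) {..<m}" for n
      proof -
        show "x n \<in> l2" by (rule l2_if_finite_support[of "{..<m}"]) (auto simp: x_def)
        have "l2_norm (x n) = L2_set (x n) {..<m}"
          by (rule l2_norm_finite_support) (auto simp: x_def)
        then show "l2_norm (x n) = L2_set (\<lambda>k. s k * ?d n k) {..<m}"
          by (simp add: x_def L2_set_def)
      qed
      have y: "y n \<in> l2" "l2_norm (y n) \<le> s m * 2" for n
      proof -
        have *: "\<bar>y n k\<bar> \<le> s m * \<bar>?d n k\<bar>" for k
          using s_le[of m k] s_pos[of k] s_pos[of m] by (auto simp: y_def abs_mult mult_right_mono)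
        show "y n \<in> l2" using s_pos[of m] by (intro l2_if_dominated[OF d(1) *]) simp
        have "l2_norm (y n) \<le> s m * l2_norm (?d n)"
          using s_pos[of m] by (intro l2_norm_dominated[OF d(1) *]) simp
        also have "\<dots> \<le> s m * 2" using d(2) s_pos[of m] by (intro mult_left_mono) auto
        finally show "l2_norm (y n) \<le> s m * 2" .
      qed
      have "(\<lambda>n. L2_set (\<lambda>k. s k * ?d n k) {..<m}) \<longlonglongrightarrow> L2_set (\<lambda>k. s k * (c k - c k)) {..<m}"
        unfolding L2_set_def by (intro tendsto_intros c)
      then have "(\<lambda>n. l2_norm (x n)) \<longlonglongrightarrow> 0"
        by (simp add: x(2) L2_set_def)
      from order_tendstoD(2)[OF this, of "e / 2"] obtain N where N: "\<And>n. n \<ge> N \<Longrightarrow> l2_norm (x n) < e / 2"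
        using \<open>e > 0\<close> by (auto simp: eventually_sequentially)
      have "l2_dist (F (r n)) (synth c) < e" if "n \<ge> N" for n
      proof -
        let ?f = "\<lambda>j. F (r n) j - synth c j"
        have "?f \<in> l2" using F[of "r n"] mem by (auto simp: unit_ball_def space_l2 intro: l2_diff)
        moreover have "U ?f = (\<lambda>k. x n k + y n k)"
          by (auto simp: x_def y_def U_diff s_coef[symmetric] coef_synth fun_eq_iff right_diff_distrib)
        ultimately have "l2_dist (F (r n)) (synth c) = l2_norm (\<lambda>k. x n k + y n k)"
          unfolding l2_dist_def using U_norm by metis
        also have "\<dots> \<le> l2_norm (x n) + l2_norm (y n)"
          using x y by (intro l2_norm_triangle)
        also have "\<dots> < e"
          using N[OF that] y(2)[of n] m by linarith
        finally show ?thesis .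
      qed
      then show ?thesis by blast
    qed
    then have "limitin l2.mtopology (F \<circ> r) (synth c) sequentially"
      using F mem by (auto simp: l2.limit_metric_sequentially unit_ball_def space_l2)
    then show "\<exists>l r. l \<in> ?B \<and> strict_mono r \<and> limitin l2.mtopology (F \<circ> r) l sequentially"
      using mem r by blast
  qed
  moreover from this have "closedin l2.mtopology ?B"
    by (rule compactin_imp_closedin[OF l2.Hausdorff_space_mtopology])
  ultimately show ?thesis
    unfolding compactly_embedded_def l2_topology_def by (simp add: closure_of_closedin)
qed

section \<open>Approximation numbers\<close>

text \<open>The competitor keeps the first \<open>n\<close> coordinates of \<open>U f\<close>; in
  the remainder every factor of \<open>coef f\<close> is at most \<open>s n\<close>.\<close>

lemma approx_number_le: "approx_number space ip n \<le> ennreal (s n)"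
proof -
  define e where "e i = (\<lambda>k. if k = i then 1 else 0 :: real)" for i :: nat
  let ?g = "\<lambda>i. U (e i)"
  let ?L = "\<lambda>i f. U f i"
  have e: "e i \<in> l2" for i
    by (rule l2_if_finite_support[of "{i}"]) (auto simp: e_def)
  have "approx_number space ip n
     \<le> (SUP f\<in>unit_ball space ip. ennreal (l2_norm (\<lambda>j. f j - (\<Sum>i<n. ?L i f * ?g i j))))"
    unfolding approx_number_def
    by (rule INF_lower2[of "(?L, ?g)"]) (auto simp: linear_functional_on_def U_add U_scale U_l2 e)
  also have "\<dots> \<le> ennreal (s n)"
  proof (rule SUP_least, rule ennreal_leI)
    fix f assume "f \<in> unit_ball space ip"
    then have f: "f \<in> space" "coef f \<in> l2" "l2_norm (coef f) \<le> 1"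
      by (auto simp: unit_ball_def hnorm_eq) (simp add: space_def)
    define t where "t k = (if k < n then 0 else U f k)" for k
    have "(\<Sum>i<n. U f i * e i k) = (if k < n then U f k else 0)" for k
      by (simp add: e_def if_distrib cong: if_cong)
    then have "t = (\<lambda>k. U f k - (\<Sum>i<n. U f i * e i k))"
      by (auto simp: t_def fun_eq_iff)
    then have Ut: "U t = (\<lambda>j. f j - (\<Sum>i<n. U f i * U (e i) j))"
      by (simp add: U_diff U_sum U_involution)
    have *: "\<bar>t k\<bar> \<le> s n * \<bar>coef f k\<bar>" for k
      using s_le[of n k] s_pos[of k] s_pos[of n]
      by (auto simp: t_def s_coef[symmetric] abs_mult mult_right_mono)
    have "t \<in> l2"
      using s_pos[of n] by (intro l2_if_dominated[OF f(2) *]) simp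
    then have "l2_norm (\<lambda>j. f j - (\<Sum>i<n. U f i * U (e i) j)) = l2_norm t"
      using U_norm Ut by metis
    also have "\<dots> \<le> s n * l2_norm (coef f)"
      using s_pos[of n] by (intro l2_norm_dominated[OF f(2) *]) simp
    also have "\<dots> \<le> s n"
      using f(3) s_pos[of n] by (simp add: mult_left_le)
    finally show "l2_norm (\<lambda>j. f j - (\<Sum>i<n. U f i * U (e i) j)) \<le> s n" .
  qed
  finally show ?thesis .
qed

lemma linear_functional_sum:
  assumes L: "linear_functional_on space L" and g: "\<And>i. g i \<in> space"
  shows "(\<lambda>j. \<Sum>i<(n::nat). c i * g i j) \<in> space \<and> L (\<lambda>j. \<Sum>i<n. c i * g i j) = (\<Sum>i<n. c i * L (g i))"
proof (induction n)
  case 0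
  have "L (\<lambda>j. 0 * g 0 j) = 0 * L (g 0)"
    using L g unfolding linear_functional_on_def by blast
  then show ?case by (simp add: space_def coef_zero l2_zero)
next
  case (Suc n)
  have "(\<lambda>j. c n * g n j) \<in> space"
    using g[of n] by (simp add: space_def coef_scale l2_scale)
  moreover have "L (\<lambda>j. c n * g n j) = c n * L (g n)"
    using L g unfolding linear_functional_on_def by blast
  ultimately show ?case
    using Suc L by (auto simp: linear_functional_on_def space_def coef_add l2_add)
qed

text \<open>The span of the first \<open>n + 1\<close> basis vectors contains a nonzero vector
  annihilated by all \<open>n\<close> functionals, and on this span the \<open>l2\<close> norm is at
  least \<open>s n\<close> times the norm of \<open>space\<close>.\<close>

lemma approx_number_ge: "ennreal (s n) \<le> approx_number space ip n"
  unfolding approx_number_def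
proof (rule INF_greatest, clarsimp)
  fix L :: "nat \<Rightarrow> (nat \<Rightarrow> real) \<Rightarrow> real" and g :: "nat \<Rightarrow> nat \<Rightarrow> real"
  assume *: "\<forall>i<n. linear_functional_on space (L i) \<and> g i \<in> l2"
  define e where "e i = (\<lambda>k. if k = i then 1 else 0 :: real)" for i :: nat
  have e: "U (e i) \<in> space" for i
    unfolding space_def mem_Collect_eq
    by (rule l2_if_finite_support[of "{i}"]) (auto simp: e_def coef_def U_involution)
  obtain c where c: "\<exists>k\<le>n. c k \<noteq> 0" "\<forall>i<n. (\<Sum>k\<le>n. c k * L i (U (e k))) = 0"
    using underdetermined_system[of n "\<lambda>i k. L i (U (e k))"] by blast
  define f where "f = (\<lambda>j. \<Sum>k<Suc n. c k * U (e k) j)"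
  have f: "f \<in> space" "L i f = 0" if "i < n" for i
    using linear_functional_sum[of "L i" "\<lambda>k. U (e k)" c "Suc n"] * that c(2) e
    unfolding f_def lessThan_Suc_atMost by auto
  have "(\<Sum>k<Suc n. c k * e k j) = (if j < Suc n then c j else 0)" for j
    unfolding e_def by (simp add: if_distrib cong: if_cong del: sum.lessThan_Suc)
  then have Uf: "U f = (\<lambda>j. if j < Suc n then c j else 0)"
    unfolding f_def U_sum U_involution by simp
  have Uf_l2: "U f \<in> l2"
    by (rule l2_if_finite_support[of "{..<Suc n}"]) (auto simp: Uf)
  have coef_l2: "coef f \<in> l2"
    by (rule l2_if_finite_support[of "{..<Suc n}"]) (auto simp: Uf coef_def)
  then have f_space: "f \<in> space"
    by (simp add: space_def)
  define w where "w = l2_norm (coef f)"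
  obtain k where "k \<le> n" "c k \<noteq> 0" using c(1) by blast
  then have "coef f k \<noteq> 0"
    using s_pos[of k] by (simp add: coef_def Uf)
  then have "w \<noteq> 0"
    using l2_norm_zero_iff[OF coef_l2] unfolding w_def by metis
  then have w: "w > 0"
    using l2_norm_nonneg[of "coef f"] by (simp add: w_def)
  define F where "F = (\<lambda>j. (1 / w) * f j)"
  have F: "F \<in> unit_ball space ip"
    using w coef_l2 unfolding F_def unit_ball_def
    by (simp add: hnorm_eq space_def coef_scale l2_scale l2_norm_scale del: times_divide_eq_left)
      (simp add: w_def)
  have LF: "L i F = 0" if "i < n" for i
  proof -
    have "L i F = (1 / w) * L i f"
      using * that f_space unfolding F_def linear_functional_on_def by blast
    then show ?thesis using f(2)[OF that] by simp
  qed
  \<comment> \<open>\<open>U f\<close> vanishes beyond \<open>n\<close>, and up to \<open>n\<close>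
    the values of \<open>s\<close> are at least \<open>s n\<close>.\<close>
  have dom: "\<bar>coef f k\<bar> \<le> (1 / s n) * \<bar>U f k\<bar>" for k
    using s_le[of k n] s_pos[of k] s_pos[of n]
    by (auto simp: coef_def Uf abs_divide divide_left_mono)
  have "w \<le> (1 / s n) * l2_norm (U f)"
    unfolding w_def using s_pos[of n] by (intro l2_norm_dominated[OF Uf_l2 dom]) simp
  then have "s n * w \<le> l2_norm f"
    using s_pos[of n] U_norm[OF Uf_l2] by (simp add: U_involution field_simps)
  then have "s n \<le> l2_norm F"
    using w unfolding F_def l2_norm_scale[OF space_l2[OF f_space]] by (simp add: field_simps)
  then have "ennreal (s n) \<le> ennreal (l2_norm (\<lambda>j. F j - (\<Sum>i<n. L i F * g i j)))"
    by (simp add: LF ennreal_leI)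
  also have "\<dots> \<le> (SUP f\<in>unit_ball space ip. ennreal (l2_norm (\<lambda>j. f j - (\<Sum>i<n. L i f * g i j))))"
    using F by (rule SUP_upper)
  finally show "ennreal (s n)
      \<le> (SUP f\<in>unit_ball space ip. ennreal (l2_norm (\<lambda>j. f j - (\<Sum>i<n. L i f * g i j))))" .
qed

lemma approx_number_eq: "approx_number space ip n = ennreal (s n)"
  using approx_number_le approx_number_ge by (rule antisym)

text \<open>A quadrature rule returns 0 for a function that vanishes at all nodes, so the integral
  of such a function is itself an error. The nodes enter as a set because they may repeat.\<close>

lemma integration_error_ge:
  assumes "\<And>X. card X \<le> n \<Longrightarrow> finite X \<Longrightarrow> \<exists>f\<in>unit_ball space ip. (\<forall>x\<in>X. f x = 0) \<and> \<delta> \<le> l2_integral h f"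
  shows "ennreal \<delta> \<le> integration_error space ip h n"
  unfolding integration_error_def
proof (rule INF_greatest, clarsimp)
  fix x :: "nat \<Rightarrow> nat" and w :: "nat \<Rightarrow> real"
  have "card (x ` {..<n}) \<le> n"
    using card_image_le[of "{..<n}" x] by simp
  then obtain f where f: "f \<in> unit_ball space ip" "\<forall>i<n. f (x i) = 0" "\<delta> \<le> l2_integral h f"
    using assms by (metis finite_imageI finite_lessThan image_eqI lessThan_iff)
  then have "ennreal \<delta> \<le> ennreal \<bar>l2_integral h f - (\<Sum>i<n. w i * f (x i))\<bar>"
    by (intro ennreal_leI) simp
  also have "\<dots> \<le> (SUP f\<in>unit_ball space ip. ennreal \<bar>l2_integral h f - (\<Sum>i<n. w i * f (x i))\<bar>)"
    using f(1) by (rule SUP_upper)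
  finally show "ennreal \<delta> \<le> (SUP f\<in>unit_ball space ip. ennreal \<bar>l2_integral h f - (\<Sum>i<n. w i * f (x i))\<bar>)" .
qed

end

section \<open>Blockwise reflections\<close>


text \<open>The squared norm 2 makes \<open>reflect\<close>, on each block, the orthogonal
  reflection in the hyperplane perpendicular to \<open>v\<close> without a normalising
  factor.\<close>

locale block_reflection =
  fixes v :: "nat \<Rightarrow> real" and blk :: "nat \<Rightarrow> nat"
  assumes finite_block: "finite (blk -` {b})"
    and v_norm: "(\<Sum>x\<in>blk -` {b}. (v x)\<^sup>2) = 2"
begin

definition pairing :: "(nat \<Rightarrow> real) \<Rightarrow> nat \<Rightarrow> real" where
  "pairing f b = (\<Sum>y\<in>blk -` {b}. v y * f y)"

definition reflect :: "(nat \<Rightarrow> real) \<Rightarrow> nat \<Rightarrow> real" where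
  "reflect f x = f x - pairing f (blk x) * v x"

lemma reflect_add: "reflect (\<lambda>j. f j + g j) = (\<lambda>j. reflect f j + reflect g j)"
  by (simp add: reflect_def pairing_def fun_eq_iff sum.distrib algebra_simps)

lemma reflect_scale: "reflect (\<lambda>j. c * f j) = (\<lambda>j. c * reflect f j)"
  by (simp add: reflect_def pairing_def fun_eq_iff sum_distrib_left algebra_simps)

lemma pairing_reflect: "pairing (reflect f) b = - pairing f b"
proof -
  have "pairing (reflect f) b = (\<Sum>y\<in>blk -` {b}. v y * f y - pairing f b * (v y)\<^sup>2)"
    unfolding pairing_def[of "reflect f"]
    by (intro sum.cong) (auto simp: reflect_def power2_eq_square algebra_simps)
  also have "\<dots> = pairing f b - pairing f b * 2"
    by (simp add: sum_subtractf sum_distrib_left[symmetric] v_norm pairing_def)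
  finally show ?thesis by simp
qed

lemma reflect_reflect: "reflect (reflect f) = f"
  by (simp add: reflect_def[of "reflect f"] pairing_reflect fun_eq_iff) (simp add: reflect_def)

lemma block_inner:
  "(\<Sum>x\<in>blk -` {b}. reflect f x * reflect g x) = (\<Sum>x\<in>blk -` {b}. f x * g x)"
proof -
  have "(\<Sum>x\<in>blk -` {b}. reflect f x * reflect g x) =
    (\<Sum>x\<in>blk -` {b}. f x * g x - pairing f b * (v x * g x) - pairing g b * (v x * f x)
       + pairing f b * pairing g b * (v x)\<^sup>2)"
    by (intro sum.cong) (auto simp: reflect_def power2_eq_square algebra_simps)
  also have "\<dots> = (\<Sum>x\<in>blk -` {b}. f x * g x)"
    by (simp add: sum.distrib sum_subtractf sum_distrib_left[symmetric] v_norm)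
      (simp add: pairing_def)
  finally show ?thesis .
qed

lemma L2_set_reflect:
  assumes "finite T"
  shows "L2_set (reflect f) (blk -` T) = L2_set f (blk -` T)"
proof -
  have "sum \<phi> (blk -` T) = (\<Sum>b\<in>T. sum \<phi> (blk -` {b}))" for \<phi> :: "nat \<Rightarrow> real"
    using sum.UNION_disjoint[of T "\<lambda>b. blk -` {b}" \<phi>] assms finite_block
    by (auto simp: vimage_UN[symmetric])
  then show ?thesis
    unfolding L2_set_def using block_inner[of f f] by (simp add: power2_eq_square)
qed

text \<open>An initial segment may cut through a block, so it is enlarged to a finite union of whole
  blocks, on which the reflection is an isometry.\<close>

lemma
  assumes "f \<in> l2"
  shows reflect_l2: "reflect f \<in> l2" and l2_norm_reflect_le: "l2_norm (reflect f) \<le> l2_norm f"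
proof -
  have *: "L2_set (reflect f) {..<n} \<le> l2_norm f" for n
  proof -
    let ?T = "blk ` {..<n}"
    have fin: "finite (blk -` ?T)"
      using finite_block by (subst vimage_eq_UN) auto
    then have "L2_set (reflect f) {..<n} \<le> L2_set (reflect f) (blk -` ?T)"
      unfolding L2_set_def by (intro real_sqrt_le_mono sum_mono2) auto
    also have "\<dots> = L2_set f (blk -` ?T)"
      by (rule L2_set_reflect) simp
    also have "\<dots> \<le> l2_norm f"
      using assms fin by (rule L2_set_le_l2_norm)
    finally show ?thesis .
  qed
  show "reflect f \<in> l2" "l2_norm (reflect f) \<le> l2_norm f"
    using l2_if_bounded[OF *] l2_norm_le[OF *] by blast+
qed

lemma l2_norm_reflect: "f \<in> l2 \<Longrightarrow> l2_norm (reflect f) = l2_norm f"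
  using l2_norm_reflect_le[of f] l2_norm_reflect_le[OF reflect_l2[of f]]
  by (simp add: reflect_reflect)

end

locale block_ellipsoid = block_reflection v blk for v blk +
  fixes s :: "nat \<Rightarrow> real"
  assumes s_pos: "0 < s k"
    and s_decseq: "decseq s"
    and s_limit: "s \<longlonglongrightarrow> 0"
begin

sublocale rotated_ellipsoid reflect s
  by unfold_locales
    (simp_all add: reflect_add reflect_scale reflect_reflect reflect_l2 l2_norm_reflect
      s_pos s_decseq s_limit)

text \<open>Before reflection the fooling function is 1 at \<open>t\<close> and is corrected at the
  nodes in \<open>F\<close> and at one free point \<open>y\<close>. By \<open>A_ge\<close> the
  corrections cost at most \<open>1 / (s t)\<^sup>2\<close> in squared norm, as much as the value at
  \<open>t\<close>; hence the factor \<open>sqrt 2\<close>. \<open>Z\<close> supplies a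
  \<open>y\<close> at which \<open>s\<close> is not below \<open>q\<close>.\<close>

lemma integration_error_block_ge:
  assumes B: "blk -` {b} = insert t F" "t \<notin> F" and vt: "v t = 1"
    and A: "0 < A" "\<And>x. x \<in> F \<Longrightarrow> v x = - s x / sqrt A"
    and Z: "Z \<subseteq> F" "M < card Z" "\<And>x. x \<in> Z \<Longrightarrow> q \<le> s x" "0 < q"
    and A_ge: "(s t)\<^sup>2 * (M + (M * (s 0)\<^sup>2)\<^sup>2 / q ^ 4) \<le> A"
    and g: "\<And>x. x \<in> F \<Longrightarrow> g x = 0" and n: "n \<le> M"
  shows "ennreal (g t * s t / sqrt 2) \<le> integration_error space ip (reflect g) n"
proof (rule integration_error_ge)
  fix X :: "nat set" assume X: "card X \<le> n" "finite X"
  have finF: "finite F"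
    using finite_block[of b] B by simp
  \<comment> \<open>\<open>Z\<close> has more than \<open>M\<close> points and there are at most
    \<open>M\<close> nodes.\<close>
  have "\<not> Z \<subseteq> X"
    using X n Z(2) card_mono[of X Z] by linarith
  then obtain y where y: "y \<in> Z" "y \<in> F" "y \<notin> X"
    using Z(1) by blast
  have v2: "(v x)\<^sup>2 = (s x)\<^sup>2 / A" if "x \<in> F" for x
    using A that by (simp add: power_divide)
  have vy: "v y \<noteq> 0"
    using A y s_pos[of y] by simp
  have sqy: "q \<le> s y"
    using Z(3) y by simp
  define a where "a = (\<Sum>x\<in>X \<inter> F. (v x)\<^sup>2)"
  text \<open>The fooling function is \<open>reflect k\<close>: the values of \<open>k\<close> on \<open>X\<close> make it vanish there, and the
    value at \<open>y\<close> normalises the pairing of \<open>k\<close> with \<open>v\<close> to 1.\<close>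
  define k where "k x = (if x = t then 1 else if x \<in> X \<inter> F then v x
    else if x = y then - a / v y else 0)" for x
  have sum: "sum \<phi> (blk -` {b}) = \<phi> t + \<phi> y + sum \<phi> (X \<inter> F)"
    if "\<And>x. k x = 0 \<Longrightarrow> \<phi> x = 0" for \<phi> :: "nat \<Rightarrow> real"
  proof -
    have "k x = 0" if "x \<notin> insert t (insert y (X \<inter> F))" for x
      using that by (auto simp: k_def)
    then have "sum \<phi> (blk -` {b}) = sum \<phi> (insert t (insert y (X \<inter> F)))"
      using finite_block[of b] B y that by (intro sum.mono_neutral_right ballI) (blast | simp)+
    then show ?thesis
      using y B(2) finF by (subst (asm) sum.insert, (auto)[2]) (subst (asm) sum.insert, auto)
  qed
  have kt: "k t = 1" and ky: "k y = - a / v y" and kX: "\<And>x. x \<in> X \<inter> F \<Longrightarrow> k x = v x"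
    using B(2) y by (auto simp: k_def)
  have k0: "k x = 0" if "blk x \<noteq> b" for x
    using that B y by (auto simp: k_def)
  \<comment> \<open>The contribution of \<open>t\<close> is 1, and that of \<open>y\<close> cancels
    the sum \<open>a\<close> over the nodes in \<open>F\<close>.\<close>
  have pb: "pairing k b = 1"
    unfolding pairing_def by (subst sum) (use vy kX in \<open>auto simp: kt ky vt a_def power2_eq_square\<close>)
  have po: "pairing k b' = 0" if "b' \<noteq> b" for b'
    unfolding pairing_def using that by (intro sum.neutral) (auto simp: k0)
  let ?f = "reflect k"
  \<comment> \<open>On the block \<open>reflect k\<close> is \<open>k\<close> minus
    \<open>v\<close>, which is zero at \<open>t\<close> and at the nodes in \<open>F\<close>; even a
    node at \<open>t\<close> thus yields no information.\<close>
  have vanish: "?f x = 0" if "x \<in> X" for x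
  proof (cases "blk x = b")
    case True
    then have "x = t \<or> x \<in> X \<inter> F" using B that by auto
    then show ?thesis using True by (auto simp: reflect_def pb kt kX vt)
  next
    case False
    then show ?thesis by (simp add: reflect_def po k0)
  qed
  have f0: "?f x = 0" if "x \<notin> blk -` {b}" for x
    using that by (simp add: reflect_def po k0)
  \<comment> \<open>The reflection preserves inner products on the block, where \<open>g\<close> is
    supported at \<open>t\<close> only.\<close>
  have int: "l2_integral (reflect g) ?f = g t"
  proof -
    have "l2_integral (reflect g) ?f = (\<Sum>x\<in>blk -` {b}. reflect g x * ?f x)"
      unfolding l2_integral_def using finite_block[of b] f0 by (intro suminf_finite) auto
    also have "\<dots> = (\<Sum>x\<in>blk -` {b}. g x * k x)"
      by (rule block_inner)
    also have "\<dots> = g t"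
      using finF B g by (simp add: kt)
    finally show ?thesis .
  qed
  have a_le: "a \<le> M * (s 0)\<^sup>2 / A" and a_nonneg: "0 \<le> a" and card_le: "card (X \<inter> F) \<le> M"
  proof -
    show c: "card (X \<inter> F) \<le> M"
      using X n card_mono[of X "X \<inter> F"] by simp
    have "a \<le> (\<Sum>x\<in>X \<inter> F. (s 0)\<^sup>2 / A)"
      unfolding a_def using A(1) s_le[of 0] s_pos
      by (intro sum_mono) (auto simp: v2 intro!: divide_right_mono power_mono dest: less_imp_le)
    also have "\<dots> \<le> M * (s 0)\<^sup>2 / A"
      using c A(1) by (simp add: divide_right_mono mult_right_mono)
    finally show "a \<le> M * (s 0)\<^sup>2 / A" .
    show "0 \<le> a" by (simp add: a_def sum_nonneg)
  qed
  \<comment> \<open>The squared norm in \<open>space\<close> splits into the shares of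
    \<open>t\<close>, \<open>y\<close> and the nodes. As \<open>v\<close> is proportional to
    \<open>s\<close> on \<open>F\<close>, each node in \<open>F\<close> costs exactly
    \<open>1 / A\<close>.\<close>
  have "(\<Sum>x\<in>blk -` {b}. (k x / s x)\<^sup>2) = 1 / (s t)\<^sup>2 + a\<^sup>2 * A / (s y) ^ 4 + card (X \<inter> F) / A"
  proof -
    have "(k y / s y)\<^sup>2 = a\<^sup>2 / ((v y)\<^sup>2 * (s y)\<^sup>2)"
      by (simp add: ky power_divide power_mult_distrib)
    also have "\<dots> = a\<^sup>2 * A / (s y) ^ 4"
      using A(1) s_pos[of y] unfolding v2[OF y(2)] by (simp add: power4_eq_xxxx power2_eq_square)
    finally have 1: "(k y / s y)\<^sup>2 = a\<^sup>2 * A / (s y) ^ 4" .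
    have "(k x / s x)\<^sup>2 = 1 / A" if "x \<in> X \<inter> F" for x
      using that A(1) s_pos[of x] by (simp add: kX power_divide v2)
    then have 2: "(\<Sum>x\<in>X \<inter> F. (k x / s x)\<^sup>2) = card (X \<inter> F) / A"
      by simp
    have "(\<Sum>x\<in>blk -` {b}. (k x / s x)\<^sup>2) =
        (k t / s t)\<^sup>2 + (k y / s y)\<^sup>2 + (\<Sum>x\<in>X \<inter> F. (k x / s x)\<^sup>2)"
      by (rule sum) simp
    then show ?thesis
      unfolding 1 2 kt by (simp add: power_divide)
  qed
  \<comment> \<open>Since \<open>a\<close> is of order \<open>1 / A\<close>, so is the share of
    \<open>y\<close>; a large \<open>A\<close> therefore suppresses both corrections.\<close>
  also have "\<dots> \<le> 1 / (s t)\<^sup>2 + (M * (s 0)\<^sup>2 / A)\<^sup>2 * A / q ^ 4 + M / A"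
    using A(1) Z(4) sqy a_le a_nonneg card_le
    by (intro add_mono order_refl frac_le mult_right_mono power_mono) auto
  also have "\<dots> = 1 / (s t)\<^sup>2 + (M + (M * (s 0)\<^sup>2)\<^sup>2 / q ^ 4) / A"
    using A(1) Z(4) by (simp add: field_simps power2_eq_square)
  also have "\<dots> \<le> 1 / (s t)\<^sup>2 + 1 / (s t)\<^sup>2"
  proof -
    have "C / A \<le> 1 / \<beta>" if "\<beta> * C \<le> A" "0 < \<beta>" for C \<beta>
      using that A(1) by (simp add: field_simps)
    from this[OF A_ge] show ?thesis
      using s_pos[of t] by simp
  qed
  finally have bound: "(\<Sum>x\<in>blk -` {b}. (k x / s x)\<^sup>2) \<le> 2 / (s t)\<^sup>2"
    by simp
  have coef: "coef ?f = (\<lambda>x. k x / s x)"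
    by (simp add: coef_def reflect_reflect fun_eq_iff)
  have coef_l2: "coef ?f \<in> l2" and "l2_norm (coef ?f) = L2_set (\<lambda>x. k x / s x) (blk -` {b})"
    unfolding coef
    by (intro l2_if_finite_support[of "blk -` {b}"] l2_norm_finite_support finite_block; simp add: k0)+
  then have norm: "l2_norm (coef ?f) \<le> sqrt 2 / s t"
    using bound s_pos[of t] by (auto simp: L2_set_def real_sqrt_divide dest: real_sqrt_le_mono)
  let ?F = "\<lambda>j. (s t / sqrt 2) * ?f j"
  have F: "?F \<in> space"
    using coef_l2 by (simp add: space_def coef_scale l2_scale del: times_divide_eq_left)
  show "\<exists>f\<in>unit_ball space ip. (\<forall>x\<in>X. f x = 0) \<and> g t * s t / sqrt 2 \<le> l2_integral (reflect g) f"
  proof (intro bexI conjI ballI)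
    have "hnorm ip ?F = (s t / sqrt 2) * l2_norm (coef ?f)"
      using s_pos[of t] unfolding hnorm_eq[OF F] coef_scale l2_norm_scale[OF coef_l2] by simp
    also have "\<dots> \<le> (s t / sqrt 2) * (sqrt 2 / s t)"
      using s_pos[of t] by (intro mult_left_mono norm) simp
    also have "\<dots> = 1"
      using s_pos[of t] by simp
    finally show "?F \<in> unit_ball space ip"
      using F by (simp add: unit_ball_def)
    show "?F x = 0" if "x \<in> X" for x
      using vanish[OF that] by simp
    have "summable (\<lambda>j. reflect g j * ?f j)"
      using finite_block[of b] f0 by (intro summable_finite) auto
    then have "l2_integral (reflect g) ?F = (s t / sqrt 2) * l2_integral (reflect g) ?f"
      unfolding l2_integral_def by (subst suminf_mult[symmetric]) (auto simp: ac_simps)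
    then show "g t * s t / sqrt 2 \<le> l2_integral (reflect g) ?F"
      by (simp add: int mult.commute)
  qed
qed

end

section \<open>The choice of the blocks\<close>

text \<open>Each odd term is at most the even one before it, so the whole series is bounded by twice
  its even part.\<close>

lemma not_summable_even:
  fixes s :: "nat \<Rightarrow> real"
  assumes "decseq s" "\<And>k. 0 \<le> s k" "\<not> summable s"
  shows "\<not> summable (\<lambda>j. s (2 * j))"
proof
  assume *: "summable (\<lambda>j. s (2 * j))"
  have "(\<Sum>k<n. s k) \<le> 2 * (\<Sum>j. s (2 * j))" for n
  proof -
    have "(\<Sum>k<n. s k) \<le> (\<Sum>k<2 * n. s k)"
      using assms(2) by (intro sum_mono2) auto
    also have "\<dots> \<le> 2 * (\<Sum>j<n. s (2 * j))"
    proof (induction n)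
      case (Suc n)
      have "s (Suc (2 * n)) \<le> s (2 * n)"
        using assms(1) by (simp add: decseq_SucD)
      with Suc show ?case by simp
    qed simp
    also have "\<dots> \<le> 2 * (\<Sum>j. s (2 * j))"
      using * assms(2) by (intro mult_left_mono sum_le_suminf) auto
    finally show ?thesis .
  qed
  then have "summable s"
    using assms(2) by (intro bounded_imp_summable[where B = "2 * (\<Sum>j. s (2 * j))"])
      (auto simp: lessThan_Suc_atMost[symmetric] simp del: sum.lessThan_Suc)
  with assms(3) show False ..
qed

text \<open>Otherwise all partial sums would be bounded by the initial part plus \<open>C\<close>.
  The demand \<open>q > m\<close> lets a block also contain a prescribed number of points.\<close>

lemma exists_large_block_sum:
  fixes s :: "nat \<Rightarrow> real"
  assumes "\<And>k. 0 \<le> s k" "\<not> summable s"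
  shows "\<exists>q>m. C \<le> sum s {p..<q}"
proof (rule ccontr)
  assume "\<not> ?thesis"
  then have *: "sum s {p..<q} < C" if "q > m" for q
    using that by (auto simp: not_le)
  have "(\<Sum>k<n. s k) \<le> sum s {..<p} + C" for n
  proof -
    have "(\<Sum>k<n. s k) \<le> sum s ({..<p} \<union> {p..<max n (Suc m)})"
      using assms(1) by (intro sum_mono2) auto
    also have "\<dots> = sum s {..<p} + sum s {p..<max n (Suc m)}"
      by (intro sum.union_disjoint) auto
    also have "\<dots> \<le> sum s {..<p} + C"
      using *[of "max n (Suc m)"] by (simp add: less_max_iff_disj)
    finally show ?thesis .
  qed
  then have "summable s"
    using assms(1) by (intro bounded_imp_summable[where B = "sum s {..<p} + C"])
      (auto simp: lessThan_Suc_atMost[symmetric] simp del: sum.lessThan_Suc)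
  with assms(2) show False ..
qed

text \<open>The demand \<open>K b q\<close> depends on \<open>q\<close>, which must therefore be
  known before the length of the block. It is read off from the first \<open>M b + 1\<close> even
  coordinates of the block, which is then extended until its sum reaches \<open>K b q\<close>, as
  divergence permits.\<close>

lemma exists_blocks:
  fixes s :: "nat \<Rightarrow> real" and M :: "nat \<Rightarrow> nat" and K :: "nat \<Rightarrow> real \<Rightarrow> real"
  assumes s: "decseq s" "\<And>k. 0 < s k" "\<not> summable (\<lambda>k. (s k)\<^sup>2)"
  obtains blk :: "nat \<Rightarrow> nat" where
    "\<And>b. finite (blk -` {b})" "\<And>b. blk (2 * b + 1) = b"
    "\<And>b. \<exists>q Z. 0 < q \<and> Z \<subseteq> {x. even x \<and> blk x = b} \<and> M b < card Z \<and> (\<forall>x\<in>Z. q \<le> s x)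
        \<and> K b q \<le> (\<Sum>x | even x \<and> blk x = b. (s x)\<^sup>2)"
proof -
  have "\<not> summable (\<lambda>j. (s (2 * j))\<^sup>2)"
    using s by (intro not_summable_even[of "\<lambda>k. (s k)\<^sup>2"])
      (auto simp: decseq_def intro!: power_mono dest: less_imp_le)
  then have ex: "\<exists>q>p + M b. K b (s (2 * (p + M b))) \<le> (\<Sum>j=p..<q. (s (2 * j))\<^sup>2)" for b p
    using exists_large_block_sum[of "\<lambda>j. (s (2 * j))\<^sup>2"] by simp
  \<comment> \<open>\<open>nx b p\<close> is the end of block \<open>b\<close> if it starts at
    \<open>p\<close>; a position \<open>j\<close> stands for the even coordinate
    \<open>2 * j\<close>.\<close>
  define nx where
    "nx b p = (SOME q. p + M b < q \<and> K b (s (2 * (p + M b))) \<le> (\<Sum>j=p..<q. (s (2 * j))\<^sup>2))" for b p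
  have nx: "nx b p > p + M b" "K b (s (2 * (p + M b))) \<le> (\<Sum>j=p..<nx b p. (s (2 * j))\<^sup>2)" for b p
    using someI_ex[OF ex[of p b]] unfolding nx_def by blast+
  define p where "p = rec_nat 0 nx"
  have p0: "p 0 = 0" and pS: "p (Suc b) = nx b (p b)" for b
    by (simp_all add: p_def)
  have mono: "strict_mono p"
    unfolding strict_mono_Suc_iff pS using nx(1) by (meson add_lessD1)
  \<comment> \<open>Each odd coordinate is the top of its own block; an even one belongs to the
    interval between consecutive values of \<open>p\<close> that contains its half.\<close>
  define blk where "blk x = (if odd x then x div 2 else LEAST b. x div 2 < p (Suc b))" for x
  have least: "(LEAST b. j < p (Suc b)) = b \<longleftrightarrow> p b \<le> j \<and> j < p (Suc b)" for j b
  proof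
    assume *: "(LEAST b. j < p (Suc b)) = b"
    have "j < p (Suc j)"
      using strict_mono_imp_increasing[OF mono, of "Suc j"] by simp
    then have "j < p (Suc b)"
      using LeastI[of "\<lambda>b. j < p (Suc b)" j] * by simp
    moreover have "p b \<le> j"
    proof (cases b)
      case (Suc b')
      then show ?thesis using not_less_Least[of b' "\<lambda>b. j < p (Suc b)"] * by simp
    qed (simp add: p0)
    ultimately show "p b \<le> j \<and> j < p (Suc b)" by simp
  next
    assume *: "p b \<le> j \<and> j < p (Suc b)"
    show "(LEAST b. j < p (Suc b)) = b"
    proof (rule Least_equality)
      fix b' assume "j < p (Suc b')"
      then have "p b < p (Suc b')" using * by simp
      then show "b \<le> b'" using mono by (simp add: strict_mono_less)
    qed (use * in simp)
  qed
  have even_blk: "{x. even x \<and> blk x = b} = (*) 2 ` {p b..<p (Suc b)}" for b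
    by (auto simp: blk_def least elim!: evenE)
  have odd_blk: "{x. odd x \<and> blk x = b} = {2 * b + 1}" for b
    by (auto simp: blk_def elim!: oddE)
  show ?thesis
  proof (rule that)
    fix b
    have "blk -` {b} = {x. even x \<and> blk x = b} \<union> {x. odd x \<and> blk x = b}"
      by auto
    then show "finite (blk -` {b})"
      unfolding even_blk odd_blk by simp
    show "blk (2 * b + 1) = b"
      by (simp add: blk_def)
    \<comment> \<open>Since \<open>s\<close> decreases, the last of these \<open>M b + 1\<close>
      coordinates provides the lower bound.\<close>
    let ?Z = "(*) 2 ` {p b..p b + M b}" and ?q = "s (2 * (p b + M b))"
    have "?Z \<subseteq> {x. even x \<and> blk x = b}"
      unfolding even_blk pS using nx(1)[of "p b" b] by (intro image_mono) auto
    moreover have "card ?Z = Suc (M b)"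
      by (subst card_image) (auto simp: inj_on_def)
    moreover have "\<forall>x\<in>?Z. ?q \<le> s x"
      using s(1) by (auto simp: decseq_def)
    moreover have "K b ?q \<le> (\<Sum>x | even x \<and> blk x = b. (s x)\<^sup>2)"
      unfolding even_blk pS using nx(2)[where b = b and p = "p b"]
      by (subst sum.reindex) (auto simp: inj_on_def)
    ultimately show "\<exists>q Z. 0 < q \<and> Z \<subseteq> {x. even x \<and> blk x = b} \<and> M b < card Z \<and> (\<forall>x\<in>Z. q \<le> s x)
        \<and> K b q \<le> (\<Sum>x | even x \<and> blk x = b. (s x)\<^sup>2)"
      using s(2) by (intro exI[of _ ?q] exI[of _ ?Z]) auto
  qed
qed

lemma strict_mono_interval:
  fixes N :: "nat \<Rightarrow> nat"
  assumes "strict_mono N" "N 0 \<le> n"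
  obtains b where "N b \<le> n" "n < N (Suc b)"
proof -
  have "n < N (Suc n)"
    using strict_mono_imp_increasing[OF assms(1), of "Suc n"] by simp
  define b where "b = (LEAST b. n < N (Suc b))"
  have "n < N (Suc b)"
    unfolding b_def by (rule LeastI) fact
  moreover have "N b \<le> n"
  proof (cases b)
    case (Suc b')
    then show ?thesis using not_less_Least[of b' "\<lambda>b. n < N (Suc b)"] b_def by simp
  qed (simp add: assms)
  ultimately show ?thesis using that by blast
qed

section \<open>Choice of the constants, the reflection and the integrand\<close>

theorem theorem6:
  fixes \<sigma> \<tau> :: "nat \<Rightarrow> real"
  assumes \<sigma>_decreasing: "\<And>j k. 1 \<le> j \<Longrightarrow> j \<le> k \<Longrightarrow> \<sigma> k \<le> \<sigma> j"
    and \<sigma>_nonneg: "\<And>k. 1 \<le> k \<Longrightarrow> 0 \<le> \<sigma> k"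
    and \<sigma>_limit: "\<sigma> \<longlonglongrightarrow> 0"
    and \<sigma>_not_square_summable: "\<not> summable (\<lambda>j. (\<sigma> (Suc j))\<^sup>2)"
    and \<tau>_decreasing: "decseq \<tau>"
    and \<tau>_nonneg: "\<And>n. 0 \<le> \<tau> n"
    and \<tau>_limit: "\<tau> \<longlonglongrightarrow> 0"
  shows "\<exists>H ip. hilbert_space_in_l2 H ip \<and> compactly_embedded H ip \<and>
    (\<forall>n. approx_number H ip n = ennreal (\<sigma> (n + 1))) \<and>
    (\<exists>h\<in>l2. l2_norm h = 1 \<and>
      (\<forall>\<^sub>F n in sequentially.
         sampling_number H ip n \<ge> integration_error H ip h n \<and>
         integration_error H ip h n \<ge> ennreal (\<tau> n)))"
proof -
  define s where "s k = \<sigma> (Suc k)" for k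
  have s_dec: "decseq s"
    using \<sigma>_decreasing by (simp add: decseq_def s_def)
  have s_lim: "s \<longlonglongrightarrow> 0"
    unfolding s_def using \<sigma>_limit by (rule LIMSEQ_Suc)
  have s_sum: "\<not> summable (\<lambda>k. (s k)\<^sup>2)"
    using \<sigma>_not_square_summable by (simp add: s_def)
  \<comment> \<open>A zero value would force all later values to vanish, and the squares would be
    summable.\<close>
  have s_pos: "0 < s k" for k
  proof (rule ccontr)
    assume "\<not> 0 < s k"
    then have "s n = 0" if "n \<ge> k" for n
      using \<sigma>_nonneg[of "Suc n"] decseqD[OF s_dec that] by (simp add: s_def)
    then have "summable (\<lambda>k. (s k)\<^sup>2)"
      by (intro summable_finite[of "{..<k}"]) auto
    with s_sum show False ..
  qed

  \<comment> \<open>The squares of the \<open>c b\<close> add up to 1, which normalises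
    \<open>h\<close>.\<close>
  define c where "c b = sqrt ((1 / 2) ^ Suc b)" for b :: nat
  \<comment> \<open>\<open>\<delta> b\<close> is the error that block \<open>b\<close> will
    guarantee. It does not involve the size of the block, so the thresholds \<open>N\<close> can be
    fixed before the blocks.\<close>
  define \<delta> where "\<delta> b = c b * s (2 * b + 1) / sqrt 2" for b
  have "\<exists>N. \<forall>n\<ge>N. \<tau> n < \<delta> b" for b
  proof -
    have "0 < \<delta> b" using s_pos by (simp add: \<delta>_def c_def)
    from order_tendstoD(2)[OF \<tau>_limit this] show ?thesis
      by (simp add: eventually_sequentially)
  qed
  then obtain N where N: "\<And>b n. N b \<le> n \<Longrightarrow> \<tau> n < \<delta> b"
    by metis
  \<comment> \<open>A majorant of \<open>N\<close>; the summand \<open>b\<close> makes it strictly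
    increasing.\<close>
  define N' where "N' b = b + (\<Sum>a\<le>b. N a)" for b
  have N'_mono: "strict_mono N'"
    by (simp add: strict_mono_Suc_iff N'_def)
  have N'_ge: "N b \<le> N' b" for b
    unfolding N'_def using member_le_sum[of b "{..b}" N] by simp

  \<comment> \<open>Block \<open>b\<close> has to serve all \<open>n\<close> from
    \<open>N' b\<close> up to \<open>N' (Suc b)\<close>; \<open>K\<close> is the size of
    \<open>A\<close> that \<open>integration_error_block_ge\<close> then requires.\<close>
  define M where "M b = N' (Suc b)" for b
  define K where "K b q = (s (2 * b + 1))\<^sup>2 * (M b + (M b * (s 0)\<^sup>2)\<^sup>2 / q ^ 4)" for b q
  obtain blk where blk: "\<And>b. finite (blk -` {b})" "\<And>b. blk (2 * b + 1) = b"
    "\<And>b. \<exists>q Z. 0 < q \<and> Z \<subseteq> {x. even x \<and> blk x = b} \<and> M b < card Z \<and> (\<forall>x\<in>Z. q \<le> s x)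
        \<and> K b q \<le> (\<Sum>x | even x \<and> blk x = b. (s x)\<^sup>2)"
    using exists_blocks[OF s_dec s_pos s_sum, of M K] by blast
  define F where "F b = {x. even x \<and> blk x = b}" for b
  define A where "A b = (\<Sum>x\<in>F b. (s x)\<^sup>2)" for b
  \<comment> \<open>On block \<open>b\<close> this is the unit vector at \<open>2 * b + 1\<close>
    minus a unit vector on \<open>F b\<close>. The two are orthogonal, whence the squared norm 2,
    and \<open>reflect\<close> exchanges them.\<close>
  define v where "v x = (if odd x then 1 else - s x / sqrt (A (blk x)))" for x
  have "x = 2 * blk x + 1" if "odd x" for x
    using blk(2) that by (metis oddE)
  then have B: "blk -` {b} = insert (2 * b + 1) (F b)" and t: "2 * b + 1 \<notin> F b" for b
    using blk(2)[of b] by (auto simp: F_def)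
  have finF: "finite (F b)" for b
    using blk(1)[of b] by (simp add: B)
  have A_pos: "0 < A b" for b
  proof -
    have "F b \<noteq> {}"
      using blk(3)[of b] unfolding F_def by fastforce
    then show ?thesis
      unfolding A_def using finF s_pos by (intro sum_pos zero_less_power) auto
  qed
  have vF: "v x = - s x / sqrt (A b)" if "x \<in> F b" for x b
    using that by (simp add: F_def v_def)
  interpret block_ellipsoid v blk s
  proof
    fix b
    show "finite (blk -` {b})" by (rule blk)
    have "(\<Sum>x\<in>F b. (v x)\<^sup>2) = (\<Sum>x\<in>F b. (s x)\<^sup>2 / A b)"
      using A_pos[of b] by (intro sum.cong) (auto simp: vF power_divide)
    also have "\<dots> = 1"
      using A_pos[of b] by (simp add: sum_divide_distrib[symmetric] A_def[symmetric])
    finally show "(\<Sum>x\<in>blk -` {b}. (v x)\<^sup>2) = 2"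
      using finF t[of b] unfolding B by (subst sum.insert) (auto simp: v_def)
  qed (fact s_pos s_dec s_lim)+

  \<comment> \<open>\<open>g\<close> lives on the top coordinates, whose unit vectors
    \<open>reflect\<close> turns into the unit vectors on the sets \<open>F b\<close>; thus
    \<open>h\<close> is the sum of the latter with weights \<open>c b\<close>.\<close>
  define g where "g x = (if odd x then c (x div 2) else 0)" for x
  define h where "h = reflect g"
  have "(\<lambda>b. (c b)\<^sup>2) sums 1"
    using power_half_series by (simp add: c_def)
  moreover have "(\<lambda>b. (g (2 * b + 1))\<^sup>2) sums 1 \<longleftrightarrow> (\<lambda>x. (g x)\<^sup>2) sums 1"
    by (rule sums_mono_reindex) (auto simp: strict_mono_def g_def image_iff elim!: oddE)
  ultimately have g_sums: "(\<lambda>x. (g x)\<^sup>2) sums 1"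
    by (simp add: g_def)
  then have g_l2: "g \<in> l2"
    by (auto simp: l2_def summable_def)
  then have g_norm: "l2_norm g = 1"
    using g_sums by (simp add: l2_norm_eq_suminf sums_iff)
  have h: "h \<in> l2" "l2_norm h = 1"
    using g_l2 g_norm by (simp_all add: h_def reflect_l2 l2_norm_reflect)

  have lower: "ennreal (\<tau> n) \<le> integration_error space ip h n" if "N' 0 \<le> n" for n
  proof -
    \<comment> \<open>The block is selected by \<open>n\<close>: from \<open>N' b\<close> on,
      \<open>\<tau>\<close> is below \<open>\<delta> b\<close>, and up to \<open>N' (Suc b)\<close>
      the bound of block \<open>b\<close> is still valid.\<close>
    obtain b where b: "N' b \<le> n" "n < N' (Suc b)"
      using strict_mono_interval[OF N'_mono \<open>N' 0 \<le> n\<close>] .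
    obtain q Z where Z: "0 < q" "Z \<subseteq> F b" "M b < card Z" "\<And>x. x \<in> Z \<Longrightarrow> q \<le> s x" "K b q \<le> A b"
      using blk(3)[of b] unfolding F_def A_def by blast
    have "\<tau> n \<le> \<delta> b"
      using N[of b n] N'_ge[of b] b by simp
    then have "ennreal (\<tau> n) \<le> ennreal (\<delta> b)"
      by (rule ennreal_leI)
    also have "\<delta> b = g (2 * b + 1) * s (2 * b + 1) / sqrt 2"
      by (simp add: \<delta>_def g_def)
    also have "ennreal \<dots> \<le> integration_error space ip h n"
      unfolding h_def
    proof (rule integration_error_block_ge[OF B t _ A_pos vF Z(2,3,4,1)])
      show "(s (2 * b + 1))\<^sup>2 * (M b + (M b * (s 0)\<^sup>2)\<^sup>2 / q ^ 4) \<le> A b"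
        using Z(5) by (simp add: K_def)
      show "n \<le> M b"
        using b by (simp add: M_def)
    qed (auto simp: v_def g_def F_def)
    finally show ?thesis .
  qed
  have "\<forall>\<^sub>F n in sequentially.
      sampling_number space ip n \<ge> integration_error space ip h n \<and>
      integration_error space ip h n \<ge> ennreal (\<tau> n)"
    using lower integration_error_le_sampling_number[OF _ h] space_l2
    unfolding eventually_sequentially by blast
  moreover have "approx_number space ip n = ennreal (\<sigma> (n + 1))" for n
    by (simp add: approx_number_eq s_def)
  ultimately show ?thesis
    using hilbert_space compact_embedding h by blast
qed

end
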